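(* Let $P$ be a finite poset with $\hat 0$ and $\hat 1$, and let $F_1,\dots,F_N$ be a lexicographic order on the facets of the order complex $\Delta(P)$. For each $k$, let $M_k$ be the set of pairs of faces of $F_k\setminus\bigcup_{i<k}F_i$ prescribed by the construction described in the context (in terms of the interval systems $I(F_k)$ and $J(F_k)$). Then $\bigcup_{k=1}^N M_k$ is an acyclic matching on the face poset of $\Delta(P)$ (with the empty face included).
   Context: Order complex and facets. $\Delta(P)$ is the simplicial complex whose faces are the chains (including the empty chain) of $P\setminus\{\hat 0,\hat 1\}$. Its facets correspond to the saturated chains $\hat 0=u_0\prec u_1\prec\cdots\prec u_s=\hat 1$ of $P$ ($\prec$ denotes a covering relation); the facet has vertices $u_1,\dots,u_{s-1}$, and the rank of $u_i$ within that facet is $i$. $P$ is not assumed graded. A facet is also identified with the set of all its faces, so $F_k\setminus\bigcup_{i<k}F_i$ is the set of faces contained in $F_k$ but in no $F_i$ with $i<k$, and $F_k\cap\bigcup_{i<k}F_i$ is the complex of faces of $F_k$ lying in some earlier facet. Lexicographic order. A total order on the facets of $\Delta(P)$ such that: whenever facets $F,F'$ have the same elements at ranks $1,\dots,i$ (for some $i\ge 0$) but different elements at rank $i+1$, and $F$ precedes $F'$, then every facet containing the elements of $F$ at ranks $1,\dots,i+1$ precedes every facet containing the elements of $F'$ at ranks $1,\dots,i+1$. Acyclic matching. The face poset is the set of faces (including $\emptyset$) ordered by inclusion. A matching on it is a set of pairwise disjoint covering pairs $\{\sigma,\tau\}$ with $\sigma\subset\tau$, $|\tau|=|\sigma|+1$.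 It is acyclic if the directed graph obtained from the Hasse diagram of the face poset by directing matching edges upward and all other edges downward has no directed cycle. Interval systems. For a lexicographic order, each inclusion-maximal face of $F_k\cap\bigcup_{i<k}F_i$ is obtained from $F_k$ by deleting the vertices in a nonempty set of consecutive ranks of $F_k$. These deleted sets are the minimal skipped intervals of $F_k$; $I(F_k)$ is the set of them ($I(F_1)=\emptyset$). The set $J(F_k)$ of pairwise disjoint intervals is obtained from $I:=I(F_k)$, starting with $J=\emptyset$, by repeating the following until $I=\emptyset$: (1) add to $J$ the interval of $I$ whose lowest element has smallest rank; (2) remove this interval from $I$ and replace every other interval of $I$ by its intersection with the set of ranks strictly above all ranks of the interval just added; (3) delete from $I$ every interval that properly contains another interval of $I$. Write $J(F_k)=\{j_1,\dots,j_r\}$ in increasing order of rank, and let $\rho_i$ be the lowest-rank element of $j_i$. The pairs $M_k$. (i) If some vertex of $F_k$ lies in no interval of $I(F_k)$, let $\rho_0$ be the lowest-rank such vertex; $M_k$ consists of the pairs $\{h\setminus\{\rho_0\},h\}$ for all faces $h\in F_k\setminus\bigcup_{i<k}F_i$ with $\rho_0\in h$. (ii) Otherwise, for a face $h\in F_k\setminus\bigcup_{i<k}F_i$ let $\tau(h)=\min\{i: 1\le i\le r,\ h\cap j_i\ne\{\rho_i\}\}$, with $\tau(h)=\infty$ if this set is empty. If $\tau(h)<\infty$, pair $h$ with $h\setminus\{\rho_{\tau(h)}\}$ if $\rho_{\tau(h)}\in h$ and with $h\cup\{\rho_{\tau(h)}\}$ otherwise. If $\tau(h)=\infty$ and some vertex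 of $F_k$ lies in no interval of $J(F_k)$, let $\rho_{r+1}$ be the lowest-rank such vertex, and pair $h$ with $h\setminus\{\rho_{r+1}\}$ if $\rho_{r+1}\in h$ and with $h\cup\{\rho_{r+1}\}$ otherwise. If $\tau(h)=\infty$ and every vertex of $F_k$ lies in some interval of $J(F_k)$, then $h$ is left unpaired. *)

theory Defs
  imports "HOL-Library.Extended_Nat"
begin

text \<open>
  A finite poset with \<open>\<hat>0\<close> and \<open>\<hat>1\<close> is a type of sort \<open>{finite, order_bot, order_top}\<close>;
  \<open>\<hat>0\<close> and \<open>\<hat>1\<close> are \<open>bot\<close> and \<open>top\<close>, which are allowed to coincide. All families of sets
  below are therefore finite.
\<close>

definition order_complex :: "'a::{finite, order_bot, order_top} set set" where
  "order_complex = {S. S \<subseteq> - {bot, top} \<and> Complete_Partial_Order.chain (\<le>) S}"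

definition maximal_faces :: "'a set set \<Rightarrow> 'a set set" where
  "maximal_faces C = {S \<in> C. \<forall>T\<in>C. S \<subseteq> T \<longrightarrow> T = S}"

abbreviation facets :: "'a::{finite, order_bot, order_top} set set" where
  "facets \<equiv> maximal_faces order_complex"

text \<open>
  The number of elements of the chain up to \<open>v\<close>. If \<open>S\<close> is the facet of the saturated chain
  \<open>\<hat>0 = u\<^sub>0 \<prec> u\<^sub>1 \<prec> \<dots> \<prec> u\<^sub>s = \<hat>1\<close>, this gives \<open>u\<^sub>i\<close> the rank \<open>i\<close>; see
  \<open>facets_eq_saturated_chains\<close> and \<open>rank_in_saturated_chain\<close> below.
\<close>
definition rank_in :: "'a::order set \<Rightarrow> 'a \<Rightarrow> nat" where
  "rank_in S v = card {w \<in> S. w \<le> v}"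

definition lowest :: "'a::order set \<Rightarrow> 'a set \<Rightarrow> 'a" where
  "lowest S A = (ARG_MIN (rank_in S) v. v \<in> A)"

definition covered_by :: "'a::order \<Rightarrow> 'a \<Rightarrow> bool" where
  "covered_by x y \<longleftrightarrow> x < y \<and> (\<nexists>z. x < z \<and> z < y)"

definition saturated_chain :: "'a::{order_bot, order_top} list \<Rightarrow> bool" where
  "saturated_chain us \<longleftrightarrow> us \<noteq> [] \<and> hd us = bot \<and> last us = top \<and> successively covered_by us"

lemma saturated_chain_sorted:
  assumes "saturated_chain us"
  shows "sorted_wrt (<) us"
proof -
  have "successively (<) us"
    using assms unfolding saturated_chain_def
    by (auto intro: successively_mono simp: covered_by_def)
  then show ?thesis
    by (simp add: successively_iff_sorted_wrt_strong)
qed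

lemma finite_chain_sorted_list:
  fixes S :: "'a::order set"
  assumes "finite S" "Complete_Partial_Order.chain (\<le>) S"
  shows "\<exists>us. set us = S \<and> sorted_wrt (<) us"
  using assms
proof (induction S rule: finite_psubset_induct)
  case (psubset S)
  show ?case
  proof (cases "S = {}")
    case False
    then obtain m where m: "m \<in> S" "\<forall>x\<in>S. \<not> x < m"
      using finite_has_minimal[OF psubset.hyps(1)] by (metis less_le)
    have lt: "m < x" if "x \<in> S - {m}" for x
      using that m psubset.prems unfolding Complete_Partial_Order.chain_def by (auto simp: less_le)
    have "Complete_Partial_Order.chain (\<le>) (S - {m})"
      using psubset.prems unfolding Complete_Partial_Order.chain_def by blast
    then obtain us where us: "set us = S - {m}" "sorted_wrt (<) us"
      using psubset.IH[of "S - {m}"] m by blast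
    then have "set (m # us) = S" "sorted_wrt (<) (m # us)"
      using lt m by auto
    then show ?thesis by blast
  qed simp
qed

lemma facet_of_saturated_chain:
  fixes us :: "'a::{finite, order_bot, order_top} list"
  assumes us: "saturated_chain us"
  shows "set us - {bot, top} \<in> facets"
proof -
  have srt: "sorted_wrt (<) us" using us by (rule saturated_chain_sorted)
  have ne: "us \<noteq> []" and hd: "hd us = bot" and la: "last us = top"
    and suc: "successively covered_by us"
    using us by (auto simp: saturated_chain_def)
  have bt: "bot \<in> set us" "top \<in> set us"
    using hd_in_set[OF ne] last_in_set[OF ne] hd la by simp_all
  have ch: "Complete_Partial_Order.chain (\<le>) (set us)"
    unfolding Complete_Partial_Order.chain_def
  proof (intro ballI)
    fix x y assume "x \<in> set us" "y \<in> set us"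
    then obtain i j where "i < length us" "x = us ! i" "j < length us" "y = us ! j"
      by (auto simp: in_set_conv_nth)
    then show "x \<le> y \<or> y \<le> x"
      using srt by (cases i j rule: linorder_cases) (auto simp: sorted_wrt_iff_nth_less less_le)
  qed
  have face: "set us - {bot, top} \<in> order_complex"
    using ch unfolding order_complex_def Complete_Partial_Order.chain_def by auto
  have "T = set us - {bot, top}"
    if T: "T \<in> order_complex" "set us - {bot, top} \<subseteq> T" for T
  proof (rule ccontr)
    assume "T \<noteq> set us - {bot, top}"
    then obtain z where z: "z \<in> T" "z \<notin> set us"
      using T unfolding order_complex_def by auto
    have cmp: "x < z \<or> z < x" if x: "x \<in> set us" for x
    proof -
      consider "x = bot" | "x = top" | "x \<in> T" using x T by blast
      then show ?thesis
      proof cases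
        case 3
        then have "x \<le> z \<or> z \<le> x"
          using z T unfolding order_complex_def Complete_Partial_Order.chain_def by blast
        then show ?thesis using z x by (auto simp: less_le)
      qed (use z bt in \<open>auto simp: less_le\<close>)
    qed
    define i where "i = (GREATEST i. i < length us \<and> us ! i < z)"
    have ex: "0 < length us \<and> us ! 0 < z"
      using ne hd cmp[OF bt(1)] by (auto simp: hd_conv_nth)
    have bd: "\<And>j. j < length us \<and> us ! j < z \<Longrightarrow> j \<le> length us" by simp
    have i: "i < length us" "us ! i < z"
      using GreatestI_nat[where P = "\<lambda>i. i < length us \<and> us ! i < z", OF ex bd]
      by (auto simp: i_def)
    have "i \<noteq> length us - 1"
      using i la ne by (auto simp: last_conv_nth)
    then have i': "Suc i < length us" using i by simp
    have "\<not> us ! Suc i < z"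
    proof
      assume "us ! Suc i < z"
      then have "Suc i \<le> i" unfolding i_def
        using Greatest_le_nat[where P = "\<lambda>i. i < length us \<and> us ! i < z", OF _ bd] i'
        by (auto simp: i_def)
      then show False by simp
    qed
    then have "z < us ! Suc i" using cmp[of "us ! Suc i"] i' by auto
    moreover have "covered_by (us ! i) (us ! Suc i)"
      using suc i' by (simp add: successively_conv_nth)
    ultimately show False using i by (auto simp: covered_by_def)
  qed
  with face show ?thesis unfolding maximal_faces_def by auto
qed

lemma saturated_chain_of_facet:
  fixes S :: "'a::{finite, order_bot, order_top} set"
  assumes "S \<in> facets"
  shows "\<exists>us. saturated_chain us \<and> S = set us - {bot, top}"
proof -
  have S: "S \<subseteq> - {bot, top}" "Complete_Partial_Order.chain (\<le>) S"
    and mx: "\<And>T. T \<in> order_complex \<Longrightarrow> S \<subseteq> T \<Longrightarrow> T = S"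
    using assms unfolding maximal_faces_def order_complex_def by auto
  have "Complete_Partial_Order.chain (\<le>) (insert bot (insert top S))"
    using S(2) unfolding Complete_Partial_Order.chain_def by auto
  then obtain us where us: "set us = insert bot (insert top S)" "sorted_wrt (<) us"
    using finite_chain_sorted_list[of "insert bot (insert top S)"] by auto
  have ne: "us \<noteq> []" using us by auto
  have "hd us = bot"
  proof -
    have "bot \<in> set us" using us by simp
    then show ?thesis using us(2) by (cases us) (auto)
  qed
  moreover have "last us = top"
  proof -
    have "top \<in> set us" using us by simp
    then show ?thesis using us(2)
      by (cases us rule: rev_cases) (auto simp: sorted_wrt_append)
  qed
  moreover have "successively covered_by us"
    unfolding successively_conv_nth
  proof (intro allI impI)
    fix i assume i: "Suc i < length us"
    have lt: "us ! i < us ! Suc i"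
      using us(2) i by (simp add: sorted_wrt_iff_nth_less)
    have False if z: "us ! i < z" "z < us ! Suc i" for z
    proof -
      have cmp: "x < z \<or> z < x" if x: "x \<in> set us" for x
      proof -
        obtain j where j: "j < length us" "x = us ! j" using x by (auto simp: in_set_conv_nth)
        show ?thesis
        proof (cases "j \<le> i")
          case True
          then have "us ! j \<le> us ! i"
            using us(2) i by (cases "j = i") (auto simp: sorted_wrt_iff_nth_less less_le)
          then show ?thesis using z j by auto
        next
          case False
          then have "us ! Suc i \<le> us ! j"
            using us(2) j by (cases "j = Suc i") (auto simp: sorted_wrt_iff_nth_less less_le)
          then show ?thesis using z j by auto
        qed
      qed
      then have nz: "z \<notin> set us" by auto
      have "insert z S \<in> order_complex"
        using S cmp nz unfolding us(1) order_complex_def Complete_Partial_Order.chain_def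
        by (auto simp: less_le)
      then have "z \<in> S" using mx[of "insert z S"] by auto
      then show False using nz us by simp
    qed
    then show "covered_by (us ! i) (us ! Suc i)" using lt by (auto simp: covered_by_def)
  qed
  ultimately have "saturated_chain us" using ne by (simp add: saturated_chain_def)
  moreover have "S = set us - {bot, top}" using us S by auto
  ultimately show ?thesis by blast
qed

lemma facets_eq_saturated_chains:
  "facets = {set us - {bot, top} | us :: 'a::{finite, order_bot, order_top} list. saturated_chain us}"
  using facet_of_saturated_chain saturated_chain_of_facet by blast

lemma rank_in_saturated_chain:
  fixes us :: "'a::{finite, order_bot, order_top} list"
  assumes us: "saturated_chain us" and i: "0 < i" "Suc i < length us"
  shows "rank_in (set us - {bot, top}) (us ! i) = i"
proof -
  have srt: "sorted_wrt (<) us" using us by (rule saturated_chain_sorted)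
  have mono: "us ! j < us ! k" if "j < k" "k < length us" for j k
    using srt that by (simp add: sorted_wrt_iff_nth_less)
  have b: "us ! 0 = bot" and t: "us ! (length us - 1) = top"
    using us by (auto simp: saturated_chain_def hd_conv_nth last_conv_nth)
  have "{w \<in> set us - {bot, top}. w \<le> us ! i} = (!) us ` {1..i}"
  proof (intro equalityI subsetI)
    fix w assume w: "w \<in> {w \<in> set us - {bot, top}. w \<le> us ! i}"
    then obtain j where j: "j < length us" "w = us ! j" by (auto simp: in_set_conv_nth)
    have "j \<noteq> 0" using w j b by (metis DiffE insertI1 mem_Collect_eq)
    moreover have "\<not> i < j" using mono[of i j] j w by auto
    ultimately show "w \<in> (!) us ` {1..i}" using j by auto
  next
    fix w assume "w \<in> (!) us ` {1..i}"
    then obtain j where j: "1 \<le> j" "j \<le> i" "w = us ! j" by auto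
    have "bot < w" using mono[of 0 j] j i b by auto
    moreover have "w < top" using mono[of j "length us - 1"] j i t by auto
    moreover have "w \<le> us ! i" using mono[of j i] j i by (cases "j = i") auto
    ultimately show "w \<in> {w \<in> set us - {bot, top}. w \<le> us ! i}" using j i by auto
  qed
  moreover have "inj_on ((!) us) {1..i}"
  proof (rule inj_onI)
    fix x y assume "x \<in> {1..i}" "y \<in> {1..i}" "us ! x = us ! y"
    then show "x = y" using mono[of x y] mono[of y x] i by (cases x y rule: linorder_cases) auto
  qed
  ultimately show ?thesis by (simp add: rank_in_def card_image)
qed

definition bottom_part :: "'a::order set \<Rightarrow> nat \<Rightarrow> 'a set" where
  "bottom_part S i = {v \<in> S. rank_in S v \<le> i}"

text \<open>
  The facets are enumerated as \<open>F 1, \<dots>, F N\<close>. Since the elements of a chain are ordered by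
  rank, two facets have the same elements at ranks \<open>1, \<dots>, i\<close> iff their sets \<open>bottom_part _ i\<close>
  agree.
\<close>
definition lexicographic_order ::
    "(nat \<Rightarrow> 'a::{finite, order_bot, order_top} set) \<Rightarrow> nat \<Rightarrow> bool" where
  "lexicographic_order F N \<longleftrightarrow>
     bij_betw F {1..N} facets \<and>
     (\<forall>a\<in>{1..N}. \<forall>b\<in>{1..N}. \<forall>i.
        bottom_part (F a) i = bottom_part (F b) i \<and>
        bottom_part (F a) (i + 1) \<noteq> bottom_part (F b) (i + 1) \<and> a < b \<longrightarrow>
        (\<forall>c\<in>{1..N}. \<forall>d\<in>{1..N}.
           bottom_part (F a) (i + 1) \<subseteq> F c \<and> bottom_part (F b) (i + 1) \<subseteq> F d \<longrightarrow> c < d))"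

definition face_covers :: "'a set set \<Rightarrow> ('a set \<times> 'a set) set" where
  "face_covers D = {(\<sigma>, \<tau>). \<sigma> \<in> D \<and> \<tau> \<in> D \<and> \<sigma> \<subset> \<tau> \<and> card \<tau> = card \<sigma> + 1}"

definition face_matching :: "'a set set \<Rightarrow> 'a set set set \<Rightarrow> bool" where
  "face_matching D M \<longleftrightarrow>
     (\<forall>e\<in>M. \<exists>(\<sigma>, \<tau>) \<in> face_covers D. e = {\<sigma>, \<tau>}) \<and> pairwise disjnt M"

definition matching_digraph :: "'a set set \<Rightarrow> 'a set set set \<Rightarrow> ('a set \<times> 'a set) set" where
  "matching_digraph D M =
     {(\<sigma>, \<tau>). (\<sigma>, \<tau>) \<in> face_covers D \<and> {\<sigma>, \<tau>} \<in> M} \<union>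
     {(\<tau>, \<sigma>). (\<sigma>, \<tau>) \<in> face_covers D \<and> {\<sigma>, \<tau>} \<notin> M}"

definition acyclic_matching :: "'a set set \<Rightarrow> 'a set set set \<Rightarrow> bool" where
  "acyclic_matching D M \<longleftrightarrow> face_matching D M \<and> acyclic (matching_digraph D M)"

definition new_faces :: "(nat \<Rightarrow> 'a set) \<Rightarrow> nat \<Rightarrow> 'a set set" where
  "new_faces F k = {h. h \<subseteq> F k \<and> (\<forall>i\<in>{1..<k}. \<not> h \<subseteq> F i)}"

definition old_faces :: "(nat \<Rightarrow> 'a set) \<Rightarrow> nat \<Rightarrow> 'a set set" where
  "old_faces F k = {h. h \<subseteq> F k \<and> (\<exists>i\<in>{1..<k}. h \<subseteq> F i)}"

text \<open>Intervals of \<open>F k\<close> are represented by their sets of vertices.\<close>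
definition I_intervals :: "(nat \<Rightarrow> 'a set) \<Rightarrow> nat \<Rightarrow> 'a set set" where
  "I_intervals F k = (\<lambda>G. F k - G) ` maximal_faces (old_faces F k)"

text \<open>
  One round of the procedure producing \<open>J\<close>: the interval chosen in step (1), and the system
  remaining after steps (2) and (3). The argument \<open>S\<close> is the facet, \<open>I\<close> the current system.
\<close>
definition first_interval :: "'a::order set \<Rightarrow> 'a set set \<Rightarrow> 'a set" where
  "first_interval S I = (ARG_MIN (\<lambda>j. rank_in S (lowest S j)) j. j \<in> I)"

definition truncate_intervals :: "'a::order set \<Rightarrow> 'a set set \<Rightarrow> 'a set set" where
  "truncate_intervals S I =
     (let j = first_interval S I in
      (\<lambda>A. A \<inter> {v \<in> S. \<forall>w\<in>j. rank_in S w < rank_in S v}) ` (I - {j}))"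

definition remove_nonminimal :: "'a set set \<Rightarrow> 'a set set" where
  "remove_nonminimal I = {A \<in> I. \<not> (\<exists>B\<in>I. B \<subset> A)}"

function J_procedure :: "'a::{finite, order} set \<Rightarrow> 'a set set \<Rightarrow> 'a set set" where
  "J_procedure S I =
     (if I = {} then {}
      else insert (first_interval S I)
             (J_procedure S (remove_nonminimal (truncate_intervals S I))))"
  by pat_completeness auto
termination
proof (relation "measure (\<lambda>(S, I). card I)")
  fix S :: "'a::{finite, order} set" and I :: "'a set set"
  assume "I \<noteq> {}"
  then have mem: "first_interval S I \<in> I"
    unfolding first_interval_def by (metis all_not_in_conv arg_min_natI)
  have "card (remove_nonminimal (truncate_intervals S I)) \<le> card (truncate_intervals S I)"
    by (rule card_mono) (auto simp: remove_nonminimal_def)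
  also have "\<dots> \<le> card (I - {first_interval S I})"
    by (simp add: truncate_intervals_def Let_def card_image_le)
  also have "\<dots> < card I"
    using mem by (intro card_Diff1_less) simp_all
  finally show "((S, remove_nonminimal (truncate_intervals S I)), (S, I))
      \<in> measure (\<lambda>(S, I). card I)" by simp
qed simp

declare J_procedure.simps [simp del]

definition J_intervals :: "(nat \<Rightarrow> 'a::{finite, order} set) \<Rightarrow> nat \<Rightarrow> 'a set set" where
  "J_intervals F k = J_procedure (F k) (I_intervals F k)"

text \<open>The interval \<open>j\<^sub>i\<close> and its lowest element \<open>\<rho>\<^sub>i\<close>, for \<open>1 \<le> i \<le> r = card (J_intervals F k)\<close>.\<close>
definition J_nth :: "(nat \<Rightarrow> 'a::{finite, order} set) \<Rightarrow> nat \<Rightarrow> nat \<Rightarrow> 'a set" where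
  "J_nth F k i =
     sorted_key_list_of_set (\<lambda>j. rank_in (F k) (lowest (F k) j)) (J_intervals F k) ! (i - 1)"

definition rho :: "(nat \<Rightarrow> 'a::{finite, order} set) \<Rightarrow> nat \<Rightarrow> nat \<Rightarrow> 'a" where
  "rho F k i = lowest (F k) (J_nth F k i)"

text \<open>The infimum of the empty set in \<^typ>\<open>enat\<close> is \<open>\<infinity>\<close>.\<close>
definition tau :: "(nat \<Rightarrow> 'a::{finite, order} set) \<Rightarrow> nat \<Rightarrow> 'a set \<Rightarrow> enat" where
  "tau F k h =
     (INF i \<in> {i \<in> {1..card (J_intervals F k)}. h \<inter> J_nth F k i \<noteq> {rho F k i}}. enat i)"

text \<open>
  In case (ii), the vertex whose insertion or deletion turns \<open>h\<close> into its partner;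
  \<open>None\<close> if \<open>h\<close> is left unpaired.
\<close>
definition pivot :: "(nat \<Rightarrow> 'a::{finite, order} set) \<Rightarrow> nat \<Rightarrow> 'a set \<Rightarrow> 'a option" where
  "pivot F k h =
     (case tau F k h of
        enat i \<Rightarrow> Some (rho F k i)
      | \<infinity> \<Rightarrow> (let U = F k - \<Union>(J_intervals F k)
              in if U \<noteq> {} then Some (lowest (F k) U) else None))"

definition toggle :: "'a \<Rightarrow> 'a set \<Rightarrow> 'a set" where
  "toggle v h = (if v \<in> h then h - {v} else insert v h)"

definition M_pairs :: "(nat \<Rightarrow> 'a::{finite, order} set) \<Rightarrow> nat \<Rightarrow> 'a set set set" where
  "M_pairs F k =
     (let U = F k - \<Union>(I_intervals F k) in
      if U \<noteq> {} then
        {{h - {lowest (F k) U}, h} | h. h \<in> new_faces F k \<and> lowest (F k) U \<in> h}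
      else
        {{h, toggle v h} | h v. h \<in> new_faces F k \<and> pivot F k h = Some v})"

end

theory Submission
  imports Defs
begin

text \<open>
  Each \<open>M\<^sub>k\<close> pairs a new face \<open>h\<close> of \<open>F\<^sub>k\<close> with the face obtained by toggling a pivot vertex of \<open>h\<close>.
  Directed edges never lead from a face to one that appears in a later facet, so a cycle stays among
  the new faces of a single \<open>F\<^sub>k\<close>, which are the subsets of \<open>F\<^sub>k\<close> that meet every interval of
  \<open>I(F\<^sub>k)\<close>. Let \<open>j\<close> be the first interval and \<open>\<rho>\<close> its lowest element. No other interval contains
  \<open>\<rho>\<close>, so on the faces with \<open>h \<inter> j \<noteq> {\<rho>}\<close> one toggles the fixed vertex \<open>\<rho>\<close>, which is
  acyclic. The faces with \<open>h \<inter> j = {\<rho>}\<close> cannot be left along a directed edge; they meet every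
  interval of the current system iff they meet every interval of the truncated, reduced system, and
  one concludes by induction along the procedure that constructs \<open>J(F\<^sub>k)\<close>.
\<close>

section \<open>Matchings given by toggling a vertex\<close>

text \<open>Along a cycle a level that never increases is constant, so a cycle of \<open>R\<close>
  would already be a cycle within one level.\<close>

lemma acyclic_by_levels:
  fixes l :: "'b \<Rightarrow> nat"
  assumes dec: "\<And>a b. (a, b) \<in> R \<Longrightarrow> l b \<le> l a"
    and lev: "\<And>n. acyclic {(a, b) \<in> R. l a = n \<and> l b = n}"
  shows "acyclic R"
proof (rule acyclicI, intro allI notI)
  have step: "l b \<le> l a \<and> (l b = l a \<longrightarrow> (a, b) \<in> {(x, y) \<in> R. l x = l a \<and> l y = l a}\<^sup>+)"
    if "(a, b) \<in> R\<^sup>+" for a b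
    using that
  proof (induction rule: trancl_induct)
    case (base y)
    then show ?case using dec by auto
  next
    case (step y z)
    have "l z \<le> l y" using dec step.hyps(2) .
    moreover have "(a, z) \<in> {(x, y) \<in> R. l x = l a \<and> l y = l a}\<^sup>+" if "l z = l a"
    proof -
      have "l y = l a" using that step.IH \<open>l z \<le> l y\<close> by linarith
      then show ?thesis
        using step.IH step.hyps(2) that
        by (auto intro: trancl_into_trancl)
    qed
    ultimately show ?case using step.IH by linarith
  qed
  fix x assume "(x, x) \<in> R\<^sup>+"
  from step[OF this] lev[of "l x"] show False
    by (auto simp: acyclic_def)
qed

definition toggle_pairs :: "'a set set \<Rightarrow> ('a set \<Rightarrow> 'a option) \<Rightarrow> 'a set set set" where
  "toggle_pairs D f = {{h, toggle v h} | h v. h \<in> D \<and> f h = Some v}"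

text \<open>An upper bound for the digraph of \<open>toggle_pairs D f\<close>, phrased through the
  pivot of the source alone: an edge survives a change of \<open>D\<close> or \<open>f\<close> as
  long as both endpoints stay in \<open>D\<close> and \<open>f\<close> agrees at the source.\<close>

definition toggle_graph :: "'a set set \<Rightarrow> ('a set \<Rightarrow> 'a option) \<Rightarrow> ('a set \<times> 'a set) set" where
  "toggle_graph D f =
     {(h, insert v h) | h v. h \<in> D \<and> insert v h \<in> D \<and> v \<notin> h \<and> f h = Some v} \<union>
     {(h, h - {x}) | h x. h \<in> D \<and> h - {x} \<in> D \<and> x \<in> h \<and> f h \<noteq> Some x}"

text \<open>This makes toggling the pivot an involution of the faces at which \<open>f\<close> is
  defined.\<close>

definition toggle_closed :: "'a set set \<Rightarrow> ('a set \<Rightarrow> 'a option) \<Rightarrow> bool" where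
  "toggle_closed D f \<longleftrightarrow>
     (\<forall>h\<in>D. \<forall>v. f h = Some v \<longrightarrow> toggle v h \<in> D \<and> f (toggle v h) = Some v)"

lemma toggle_toggle [simp]: "toggle v (toggle v h) = h"
  by (auto simp: toggle_def)

lemma toggle_closedD:
  assumes "toggle_closed D f" "h \<in> D" "f h = Some v"
  shows "toggle v h \<in> D" "f (toggle v h) = Some v"
  using assms by (auto simp: toggle_closed_def)

lemma toggle_graph_upI:
  "a \<in> D \<Longrightarrow> insert v a \<in> D \<Longrightarrow> v \<notin> a \<Longrightarrow> f a = Some v \<Longrightarrow> (a, insert v a) \<in> toggle_graph D f"
  by (auto simp: toggle_graph_def)

lemma toggle_graph_downI:
  "a \<in> D \<Longrightarrow> a - {x} \<in> D \<Longrightarrow> x \<in> a \<Longrightarrow> f a \<noteq> Some x \<Longrightarrow> (a, a - {x}) \<in> toggle_graph D f"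
  by (auto simp: toggle_graph_def)

lemma toggle_graphE:
  assumes "(a, b) \<in> toggle_graph D f"
  obtains (up) v where "a \<in> D" "b \<in> D" "v \<notin> a" "f a = Some v" "b = insert v a"
    | (down) x where "a \<in> D" "b \<in> D" "x \<in> a" "f a \<noteq> Some x" "b = a - {x}"
  using assms unfolding toggle_graph_def by blast

text \<open>By closedness both members of a pair have the same pivot and generate the same pair. So
  a pair is determined by either member, and two pairs with a common member coincide.\<close>

lemma face_matching_toggle_pairs:
  fixes D :: "'a::finite set set"
  assumes cl: "toggle_closed D f"
  shows "face_matching D (toggle_pairs D f)"
  unfolding face_matching_def
proof (intro conjI ballI)
  fix e assume "e \<in> toggle_pairs D f"
  then obtain h v where h: "h \<in> D" "f h = Some v" "e = {h, toggle v h}"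
    by (auto simp: toggle_pairs_def)
  have tD: "toggle v h \<in> D" using toggle_closedD[OF cl h(1,2)] by simp
  show "\<exists>(\<sigma>, \<tau>) \<in> face_covers D. e = {\<sigma>, \<tau>}"
  proof (cases "v \<in> h")
    case True
    then have "card h = card (h - {v}) + 1" using card_Suc_Diff1[of h v] by simp
    then have "(toggle v h, h) \<in> face_covers D"
      using True h tD by (auto simp: face_covers_def toggle_def)
    then show ?thesis using h by (auto simp: insert_commute)
  next
    case False
    then have "(h, toggle v h) \<in> face_covers D"
      using h tD by (auto simp: face_covers_def toggle_def)
    then show ?thesis using h by auto
  qed
next
  have eq: "f x = Some v \<and> {x, toggle v x} = {h, toggle v h}"
    if "h \<in> D" "f h = Some v" "x \<in> {h, toggle v h}" for h v x
  proof (cases "x = h")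
    case False
    then have "x = toggle v h" using that(3) by simp
    then show ?thesis using toggle_closedD(2)[OF cl that(1,2)] by (simp add: insert_commute)
  qed (use that(2) in simp)
  have same: "{h, toggle v h} = {g, toggle w g}"
    if "h \<in> D" "f h = Some v" "g \<in> D" "f g = Some w" "x \<in> {h, toggle v h}" "x \<in> {g, toggle w g}"
    for h v g w x
    using eq[OF that(1,2,5)] eq[OF that(3,4,6)] by simp
  show "pairwise disjnt (toggle_pairs D f)"
  proof (intro pairwiseI)
    fix a b assume ab: "a \<in> toggle_pairs D f" "b \<in> toggle_pairs D f" "a \<noteq> b"
    obtain h v where h: "h \<in> D" "f h = Some v" "a = {h, toggle v h}"
      using ab(1) unfolding toggle_pairs_def by blast
    obtain g w where g: "g \<in> D" "f g = Some w" "b = {g, toggle w g}"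
      using ab(2) unfolding toggle_pairs_def by blast
    show "disjnt a b"
    proof (rule ccontr)
      assume "\<not> disjnt a b"
      then obtain x where x: "x \<in> a" "x \<in> b" by (auto simp: disjnt_iff)
      then have "a = b"
        using same[OF h(1,2) g(1,2) x[unfolded h(3) g(3)]] h(3) g(3) by simp
      then show False using ab(3) by simp
    qed
  qed
qed

lemma card_succ_subsetE:
  assumes "finite \<tau>" "\<sigma> \<subset> \<tau>" "card \<tau> = card \<sigma> + 1"
  obtains x where "x \<notin> \<sigma>" "\<tau> = insert x \<sigma>"
proof -
  have "card (\<tau> - \<sigma>) = 1"
    using assms card_Diff_subset[of \<sigma> \<tau>] by (auto simp: finite_subset psubset_imp_subset)
  then obtain x where "\<tau> - \<sigma> = {x}" by (auto simp: card_1_singleton_iff)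
  then show thesis using assms(2) by (intro that[of x]) auto
qed

lemma matching_digraph_toggle_pairs:
  fixes D :: "'a::finite set set"
  assumes cl: "toggle_closed D f"
  shows "matching_digraph D (toggle_pairs D f) \<subseteq> toggle_graph D f"
proof (rule subrelI)
  fix a b assume "(a, b) \<in> matching_digraph D (toggle_pairs D f)"
  then consider (up) "(a, b) \<in> face_covers D" "{a, b} \<in> toggle_pairs D f"
    | (down) "(b, a) \<in> face_covers D" "{b, a} \<notin> toggle_pairs D f"
    unfolding matching_digraph_def by auto
  then show "(a, b) \<in> toggle_graph D f"
  proof cases
    case up
    then have D: "a \<in> D" "b \<in> D" and "a \<subset> b" "card b = card a + 1"
      by (auto simp: face_covers_def)
    then obtain x where x: "x \<notin> a" "b = insert x a" by (meson card_succ_subsetE finite)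
    obtain h v where h: "h \<in> D" "f h = Some v" "{a, b} = {h, toggle v h}"
      using up(2) unfolding toggle_pairs_def by blast
    \<comment> \<open>The pair may have been generated from \<open>b\<close> rather than from
      \<open>a\<close>; closedness gives both the same pivot.\<close>
    have "f a = Some v" "b = toggle v a"
      using h toggle_closedD[OF cl h(1,2)] by (auto simp: doubleton_eq_iff)
    moreover have "v = x" using x \<open>b = toggle v a\<close> by (auto simp: toggle_def split: if_splits)
    ultimately show ?thesis using x D toggle_graph_upI[of a D x f] by simp
  next
    case down
    then have D: "a \<in> D" "b \<in> D" and "b \<subset> a" "card a = card b + 1"
      by (auto simp: face_covers_def)
    then obtain x where x: "x \<notin> b" "a = insert x b" by (meson card_succ_subsetE finite)
    have "f a \<noteq> Some x"
    proof
      assume "f a = Some x"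
      then have "{a, toggle x a} \<in> toggle_pairs D f" using D unfolding toggle_pairs_def by blast
      moreover have "toggle x a = b" using x by (auto simp: toggle_def)
      ultimately show False using down(2) by (simp add: insert_commute)
    qed
    moreover have "b = a - {x}" "x \<in> a" using x by auto
    ultimately show ?thesis using D toggle_graph_downI[of a D x f] by simp
  qed
qed

text \<open>For \<open>V = Some v\<close> an upward edge inserts \<open>v\<close> and a downward
  edge never deletes it, so \<open>v\<close> is gained at most once along a path. All other edges,
  and all edges if \<open>V = None\<close>, strictly shrink the face.\<close>

lemma acyclic_toggle_graph_const:
  fixes D :: "'a::finite set set"
  shows "acyclic (toggle_graph D (\<lambda>_. V))"
proof (rule acyclic_by_levels)
  define l :: "'a set \<Rightarrow> nat" where "l a = (case V of None \<Rightarrow> 0 | Some v \<Rightarrow> if v \<in> a then 0 else 1)" for a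
  have step: "l b \<le> l a \<and> (b \<subset> a \<or> l b \<noteq> l a)" if "(a, b) \<in> toggle_graph D (\<lambda>_. V)" for a b
    using that by (cases rule: toggle_graphE) (auto simp: l_def split: option.splits)
  then show "(a, b) \<in> toggle_graph D (\<lambda>_. V) \<Longrightarrow> l b \<le> l a" for a b by blast
  fix n
  let ?R = "{(a, b) \<in> toggle_graph D (\<lambda>_. V). l a = n \<and> l b = n}"
  have "?R \<subseteq> {(a, b). b \<subset> a}"
    using step by auto
  moreover have "acyclic ({(a, b). b \<subset> a} :: ('a set \<times> 'a set) set)"
    using wf_acyclic[OF wf_finite_psubset[where 'a = 'a]]
      acyclic_converse[of "{(a, b). b \<subset> a} :: ('a set \<times> 'a set) set"]
    by (simp add: finite_psubset_def converse_unfold)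
  ultimately show "acyclic ?R"
    by (rule acyclic_subset[rotated])
qed

section \<open>Interval systems on a chain\<close>

lemma rank_in_mono:
  fixes S :: "'a::{finite, order} set"
  assumes "v \<le> w"
  shows "rank_in S v \<le> rank_in S w"
  unfolding rank_in_def using assms by (intro card_mono) auto

lemma rank_in_strict_mono:
  fixes S :: "'a::{finite, order} set"
  assumes "v < w" "w \<in> S"
  shows "rank_in S v < rank_in S w"
proof -
  have "w \<in> {x \<in> S. x \<le> w}" "w \<notin> {x \<in> S. x \<le> v}" using assms by auto
  then have "{x \<in> S. x \<le> v} \<subset> {x \<in> S. x \<le> w}"
    using assms by auto
  then show ?thesis
    unfolding rank_in_def by (intro psubset_card_mono) auto
qed

lemma rank_in_less_iff:
  fixes S :: "'a::{finite, order} set"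
  assumes "Complete_Partial_Order.chain (\<le>) S" "v \<in> S" "w \<in> S"
  shows "rank_in S v < rank_in S w \<longleftrightarrow> v < w"
  using assms rank_in_strict_mono[of v w S] rank_in_mono[of w v S]
  unfolding Complete_Partial_Order.chain_def by (metis leD le_less)

lemma rank_in_le_iff:
  fixes S :: "'a::{finite, order} set"
  assumes "Complete_Partial_Order.chain (\<le>) S" "v \<in> S" "w \<in> S"
  shows "rank_in S v \<le> rank_in S w \<longleftrightarrow> v \<le> w"
  using assms rank_in_less_iff[of S w v] rank_in_mono[of v w S]
  unfolding Complete_Partial_Order.chain_def by (metis leD le_less not_less)

lemma lowest_props:
  fixes S :: "'a::{finite, order} set"
  assumes "Complete_Partial_Order.chain (\<le>) S" "A \<subseteq> S" "A \<noteq> {}"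
  shows "lowest S A \<in> A" "\<And>x. x \<in> A \<Longrightarrow> lowest S A \<le> x"
proof -
  obtain a where "a \<in> A" using assms by blast
  then show l: "lowest S A \<in> A"
    unfolding lowest_def by (rule arg_min_natI)
  fix x assume "x \<in> A"
  then have "rank_in S (lowest S A) \<le> rank_in S x"
    unfolding lowest_def by (rule arg_min_nat_le)
  then show "lowest S A \<le> x"
    using rank_in_le_iff assms l \<open>x \<in> A\<close> by blast
qed

text \<open>The invariant of the construction of J: it holds for \<open>I_intervals F k\<close> and
  is kept by each round (\<open>interval_system_next\<close>). Intervals of ranks appear as convex
  subsets of the chain.\<close>

definition interval_system :: "'a::order set \<Rightarrow> 'a set set \<Rightarrow> bool" where
  "interval_system S I \<longleftrightarrow>
     Complete_Partial_Order.chain (\<le>) S \<and>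
     (\<forall>A\<in>I. A \<noteq> {} \<and> A \<subseteq> S \<and> (\<forall>x\<in>A. \<forall>y\<in>A. \<forall>z\<in>S. x \<le> z \<and> z \<le> y \<longrightarrow> z \<in> A)) \<and>
     (\<forall>A\<in>I. \<forall>B\<in>I. A \<subseteq> B \<longrightarrow> A = B)"

lemma interval_systemD:
  assumes "interval_system S I"
  shows "Complete_Partial_Order.chain (\<le>) S"
    and "A \<in> I \<Longrightarrow> A \<noteq> {}" and "A \<in> I \<Longrightarrow> A \<subseteq> S"
    and "A \<in> I \<Longrightarrow> x \<in> A \<Longrightarrow> y \<in> A \<Longrightarrow> z \<in> S \<Longrightarrow> x \<le> z \<Longrightarrow> z \<le> y \<Longrightarrow> z \<in> A"
    and "A \<in> I \<Longrightarrow> B \<in> I \<Longrightarrow> A \<subseteq> B \<Longrightarrow> A = B"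
  using assms unfolding interval_system_def by blast+

definition next_system :: "'a::order set \<Rightarrow> 'a set set \<Rightarrow> 'a set set" where
  "next_system S I = remove_nonminimal (truncate_intervals S I)"

context
  fixes S :: "'a::{finite, order} set" and I j \<rho>
  assumes sys: "interval_system S I" and ne: "I \<noteq> {}"
    and j_def: "j = first_interval S I" and rho_def: "\<rho> = lowest S j"
begin

lemma first_in: "j \<in> I"
  unfolding j_def first_interval_def using ne by (metis all_not_in_conv arg_min_natI)

lemma first_rho: "\<rho> \<in> j" "x \<in> j \<Longrightarrow> \<rho> \<le> x"
  unfolding rho_def
  using lowest_props[OF interval_systemD(1)[OF sys] interval_systemD(3,2)[OF sys first_in]] by simp_all

text \<open>By the choice of \<open>j\<close> no interval starts below \<open>\<rho>\<close>.
  Another interval containing \<open>\<rho>\<close> would start at \<open>\<rho>\<close> too, and of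
  two intervals with the same lowest element one contains the other, which the antichain condition
  forbids.\<close>

lemma rho_less:
  assumes A: "A \<in> I" "A \<noteq> j" and x: "x \<in> A"
  shows "\<rho> < x"
proof -
  note D = interval_systemD[OF sys]
  note lA = lowest_props[OF D(1) D(3)[OF A(1)] D(2)[OF A(1)]]
  have in_S: "j \<subseteq> S" "A \<subseteq> S" using D(3) first_in A by auto
  have "rank_in S \<rho> \<le> rank_in S (lowest S A)"
    using A(1) unfolding rho_def j_def first_interval_def
    by (rule arg_min_nat_le)
  then have le: "\<rho> \<le> lowest S A"
    using rank_in_le_iff[OF D(1)] in_S first_rho(1) lA(1) by blast
  have "\<rho> \<notin> A"
  proof
    assume "\<rho> \<in> A"
    have "A \<subseteq> j" if nsub: "\<not> j \<subseteq> A"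
    proof
      fix x assume "x \<in> A"
      obtain y where y: "y \<in> j" "y \<notin> A" using nsub by blast
      have "x \<le> y \<or> y \<le> x"
        using D(1) in_S y \<open>x \<in> A\<close> unfolding Complete_Partial_Order.chain_def by blast
      moreover have "\<not> y \<le> x"
        using D(4)[OF A(1) \<open>\<rho> \<in> A\<close> \<open>x \<in> A\<close>, of y] y in_S first_rho(2)[OF y(1)] by auto
      moreover have "\<rho> \<le> x" using le lA(2)[OF \<open>x \<in> A\<close>] by simp
      ultimately show "x \<in> j"
        using D(4)[OF first_in first_rho(1) y(1), of x] \<open>x \<in> A\<close> in_S by blast
    qed
    then show False using D(5) A first_in by blast
  qed
  then show ?thesis using le lA(2)[OF x] x by (metis order.trans le_less)
qed

lemma truncate_eq:
  "truncate_intervals S I = (\<lambda>A. {x \<in> A. \<forall>w\<in>j. w < x}) ` (I - {j})"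
proof -
  note D = interval_systemD[OF sys]
  have "A \<inter> {v \<in> S. \<forall>w\<in>j. rank_in S w < rank_in S v} = {x \<in> A. \<forall>w\<in>j. w < x}" if "A \<in> I" for A
    using rank_in_less_iff[OF D(1)] D(3)[OF that] D(3)[OF first_in] by blast
  then show ?thesis
    unfolding truncate_intervals_def Let_def j_def[symmetric] by (intro image_cong) auto
qed

text \<open>What step (2) cuts off from an interval lies in \<open>j - {\<rho>}\<close>, by
  convexity of \<open>j\<close>. A face that meets \<open>j\<close> only in \<open>\<rho>\<close>
  does not see the difference.\<close>

lemma not_truncated:
  assumes "A \<in> I" "A \<noteq> j" "x \<in> A" "\<not> (\<forall>w\<in>j. w < x)"
  shows "x \<in> j" "x \<noteq> \<rho>"
proof -
  note D = interval_systemD[OF sys]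
  obtain w where w: "w \<in> j" "\<not> w < x" using assms by blast
  have "x \<le> w"
    using D(1,3) first_in assms w unfolding Complete_Partial_Order.chain_def
    by (metis less_le subsetD)
  moreover have "\<rho> < x" using rho_less assms by blast
  ultimately show "x \<in> j" "x \<noteq> \<rho>"
    using D(4)[OF first_in first_rho(1) w(1), of x] D(3)[OF assms(1)] assms(3) by auto
qed

lemma next_systemE:
  assumes "B \<in> next_system S I"
  obtains A where "A \<in> I" "A \<noteq> j" "B = {x \<in> A. \<forall>w\<in>j. w < x}"
proof -
  have "B \<in> truncate_intervals S I"
    using assms by (simp add: next_system_def remove_nonminimal_def)
  then show thesis using that unfolding truncate_eq by auto
qed

lemma next_system_above:
  assumes "B \<in> next_system S I" "x \<in> B" "w \<in> j"
  shows "w < x"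
  using assms by (auto elim: next_systemE)

text \<open>The truncated \<open>A\<close> contains an inclusion-minimal truncated interval, which
  step (3) keeps.\<close>

lemma next_system_below:
  assumes "A \<in> I" "A \<noteq> j"
  obtains B where "B \<in> next_system S I" "B \<subseteq> A"
proof -
  let ?A = "{x \<in> A. \<forall>w\<in>j. w < x}"
  have "?A \<in> truncate_intervals S I" using assms by (auto simp: truncate_eq)
  then obtain B where B: "B \<in> truncate_intervals S I" "B \<subseteq> ?A"
    "\<And>C. C \<in> truncate_intervals S I \<Longrightarrow> C \<subseteq> B \<Longrightarrow> B = C"
    using finite_has_minimal2[of "truncate_intervals S I" ?A] by auto
  then show thesis by (intro that[of B]) (auto simp: next_system_def remove_nonminimal_def)
qed

lemma interval_system_next: "interval_system S (next_system S I)"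
  unfolding interval_system_def
proof (intro conjI ballI impI allI)
  note D = interval_systemD[OF sys]
  show "Complete_Partial_Order.chain (\<le>) S" by (rule D)
  fix B assume B: "B \<in> next_system S I"
  obtain A where A: "A \<in> I" "A \<noteq> j" "B = {x \<in> A. \<forall>w\<in>j. w < x}"
    using B by (rule next_systemE)
  \<comment> \<open>If nothing of \<open>A\<close> survived the truncation, \<open>A\<close> would
    lie inside \<open>j\<close>, against the antichain condition.\<close>
  show "B \<noteq> {}"
    using not_truncated(1)[OF A(1,2)] D(5)[OF A(1) first_in] A(2,3) by blast
  show "B \<subseteq> S" using A D(3) by blast
  show "z \<in> B" if "x \<in> B" "y \<in> B" "z \<in> S" "x \<le> z \<and> z \<le> y" for x y z
    using D(4)[OF A(1), of x y z] that A(3) by (auto intro: less_le_trans)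
  show "B = C" if "C \<in> next_system S I" "B \<subseteq> C" for C
    using B that unfolding next_system_def remove_nonminimal_def by blast
qed

end

lemma J_procedure_next:
  assumes "I \<noteq> {}"
  shows "J_procedure S I = insert (first_interval S I) (J_procedure S (next_system S I))"
  using J_procedure.simps[of S I] assms by (simp add: next_system_def)

lemma J_procedure_empty [simp]: "J_procedure S {} = {}"
  by (simp add: J_procedure.simps)

text \<open>An interval of J need not belong to \<open>I\<close>: those added in later rounds are
  truncations, hence only contained in a member of \<open>I\<close>.\<close>

lemma J_procedure_within:
  fixes S :: "'a::{finite, order} set"
  assumes "interval_system S I" "B \<in> J_procedure S I"
  shows "B \<noteq> {}" "B \<subseteq> S" "\<exists>A\<in>I. B \<subseteq> A"
proof -
  have "B \<noteq> {} \<and> B \<subseteq> S \<and> (\<exists>A\<in>I. B \<subseteq> A)"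
    using assms
  proof (induction S I rule: J_procedure.induct)
    case (1 S I)
    show ?case
    proof (cases "I = {}")
      case False
      note sys = 1(2)
      note ctx = sys False refl refl
      have fi: "first_interval S I \<in> I" by (rule first_in[OF ctx])
      show ?thesis
      proof (cases "B = first_interval S I")
        case True
        then show ?thesis using fi interval_systemD(2,3)[OF sys fi] by auto
      next
        case neq: False
        then have "B \<in> J_procedure S (next_system S I)"
          using 1(3) False by (simp add: J_procedure_next)
        then have B: "B \<noteq> {} \<and> B \<subseteq> S \<and> (\<exists>A\<in>next_system S I. B \<subseteq> A)"
          using 1(1)[OF False] interval_system_next[OF ctx] by (simp add: next_system_def)
        then obtain C where "C \<in> next_system S I" "B \<subseteq> C" by blast
        moreover obtain A where "A \<in> I" "C = {x \<in> A. \<forall>w\<in>first_interval S I. w < x}"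
          using \<open>C \<in> next_system S I\<close> by (rule next_systemE[OF ctx])
        ultimately show ?thesis using B by blast
      qed
    qed (use 1(3) in simp)
  qed
  then show "B \<noteq> {}" "B \<subseteq> S" "\<exists>A\<in>I. B \<subseteq> A" by auto
qed

section \<open>Sorted lists for a key that is injective on the given set\<close>

context linorder
begin

text \<open>Distinct sets may have the same lowest element, so the key is injective only on the
  family at hand, which therefore serves as the carrier of the locale.\<close>

lemma set_sorted_key_list_of_set_inj_on:
  assumes "inj_on f A" "finite A"
  shows "set (sorted_key_list_of_set f A) = A"
proof -
  interpret folding_insort_key less_eq less A f
    by unfold_locales (rule assms)
  show ?thesis using assms by (simp add: set_sorted_key_list_of_set)
qed

lemma length_sorted_key_list_of_set_inj_on:
  assumes "inj_on f A"
  shows "length (sorted_key_list_of_set f A) = card A"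
proof -
  interpret folding_insort_key less_eq less A f
    by unfold_locales (rule assms)
  show ?thesis by simp
qed

lemma sorted_key_list_of_set_Nil: "sorted_key_list_of_set f {} = []"
proof -
  interpret folding_insort_key less_eq less "{}" f
    by unfold_locales simp
  show ?thesis by (rule sorted_key_list_of_set_empty)
qed

lemma sorted_key_list_of_set_insert_least:
  assumes inj: "inj_on f (insert x A)" and "finite A" and less: "\<And>y. y \<in> A \<Longrightarrow> less (f x) (f y)"
  shows "sorted_key_list_of_set f (insert x A) = x # sorted_key_list_of_set f A"
proof -
  interpret folding_insort_key less_eq less "insert x A" f
    by unfold_locales (rule inj)
  have "x \<notin> A" using less by blast
  then have "sorted_key_list_of_set f (insert x A) = insort_key f x (sorted_key_list_of_set f A)"
    using assms(2) by (intro sorted_key_list_of_set_insert) auto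
  also have "\<dots> = x # sorted_key_list_of_set f A"
    using less set_sorted_key_list_of_set[OF subset_insertI assms(2)]
    by (intro insort_is_Cons) (auto intro: less_imp_le)
  finally show ?thesis .
qed

end

section \<open>The intervals of J listed by increasing rank\<close>

abbreviation low_rank :: "'a::order set \<Rightarrow> 'a set \<Rightarrow> nat" where
  "low_rank S j \<equiv> rank_in S (lowest S j)"

text \<open>The enumeration of J by rank. As a list it turns the minimum in the definition of \<tau>
  into a search for the first suitable entry.\<close>

definition J_list :: "'a::{finite, order} set \<Rightarrow> 'a set set \<Rightarrow> 'a set list" where
  "J_list S I = sorted_key_list_of_set (low_rank S) (J_procedure S I)"

context
  fixes S :: "'a::{finite, order} set" and I j
  assumes sys: "interval_system S I" and ne: "I \<noteq> {}" and j_def: "j = first_interval S I"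
begin

lemma J_procedure_above:
  assumes "B \<in> J_procedure S (next_system S I)" "x \<in> B" "w \<in> j"
  shows "w < x"
  using J_procedure_within(3)[OF interval_system_next[OF sys ne j_def refl] assms(1)] assms(2,3)
    next_system_above[OF sys ne j_def refl]
  by blast

lemma low_rank_above:
  assumes B: "B \<in> J_procedure S (next_system S I)"
  shows "low_rank S j < low_rank S B"
proof -
  note nxt = interval_system_next[OF sys ne j_def refl]
  have lB: "lowest S B \<in> B"
    using lowest_props(1)[OF interval_systemD(1)[OF sys]] J_procedure_within(1,2)[OF nxt B] by blast
  have "lowest S j < lowest S B"
    using J_procedure_above[OF B lB] first_rho(1)[OF sys ne j_def refl] by blast
  then show ?thesis using rank_in_strict_mono lB J_procedure_within(2)[OF nxt B] by blast
qed

end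

text \<open>Lowest ranks strictly increase from round to round. The injectivity is what the lemmas
  on \<open>sorted_key_list_of_set\<close> require.\<close>

lemma inj_on_low_rank:
  fixes S :: "'a::{finite, order} set"
  assumes "interval_system S I"
  shows "inj_on (low_rank S) (J_procedure S I)"
  using assms
proof (induction S I rule: J_procedure.induct)
  case (1 S I)
  show ?case
  proof (cases "I = {}")
    case False
    note ctx = 1(2) False refl
    have "inj_on (low_rank S) (J_procedure S (next_system S I))"
      using 1(1)[OF False] interval_system_next[OF ctx refl] by (simp add: next_system_def)
    then show ?thesis
      using low_rank_above[OF ctx] unfolding J_procedure_next[OF False] inj_on_insert
      by fastforce
  qed simp
qed

lemma set_J_list:
  fixes S :: "'a::{finite, order} set"
  assumes "interval_system S I"
  shows "set (J_list S I) = J_procedure S I"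
  unfolding J_list_def using inj_on_low_rank[OF assms]
  by (simp add: set_sorted_key_list_of_set_inj_on)

lemma J_list_empty [simp]:
  fixes S :: "'a::{finite, order} set"
  shows "J_list S {} = []"
  by (simp add: J_list_def sorted_key_list_of_set_Nil)

text \<open>The procedure picks the intervals in increasing order of rank, so sorting reproduces the
  order of the rounds.\<close>

lemma J_list_Cons:
  fixes S :: "'a::{finite, order} set"
  assumes sys: "interval_system S I" and ne: "I \<noteq> {}"
  shows "J_list S I = first_interval S I # J_list S (next_system S I)"
  using inj_on_low_rank[OF sys] low_rank_above[OF sys ne refl]
  unfolding J_list_def J_procedure_next[OF ne]
  by (intro sorted_key_list_of_set_insert_least) auto

section \<open>The matching of a facet\<close>

text \<open>For \<open>F k\<close> and \<open>I_intervals F k\<close> these are the new faces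
  (\<open>new_faces_eq_transversals\<close>); arbitrary systems are allowed so that one can induct
  over the rounds.\<close>

definition transversals :: "'a set \<Rightarrow> 'a set set \<Rightarrow> 'a set set" where
  "transversals S I = {h. h \<subseteq> S \<and> (\<forall>A\<in>I. h \<inter> A \<noteq> {})}"

text \<open>The pivot of case (ii) in a form that follows the rounds. \<open>V\<close> stands for
  the answer when \<tau> is infinite: the lowest vertex outside all intervals of J, or
  \<open>None\<close>. It stays fixed while \<open>I\<close> shrinks.\<close>

definition J_pivot :: "'a::{finite, order} set \<Rightarrow> 'a set set \<Rightarrow> 'a option \<Rightarrow> 'a set \<Rightarrow> 'a option" where
  "J_pivot S I V h =
     (case List.find (\<lambda>j. h \<inter> j \<noteq> {lowest S j}) (J_list S I) of
        Some j \<Rightarrow> Some (lowest S j) | None \<Rightarrow> V)"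

lemma J_pivot_empty [simp]: "J_pivot S {} V = (\<lambda>_. V)"
  by (simp add: J_pivot_def fun_eq_iff)

lemma J_pivot_next:
  assumes "interval_system S I" "I \<noteq> {}" "j = first_interval S I" "\<rho> = lowest S j"
  shows "J_pivot S I V h = (if h \<inter> j \<noteq> {\<rho>} then Some \<rho> else J_pivot S (next_system S I) V h)"
  using assms by (simp add: J_pivot_def J_list_Cons)

lemma J_pivot_SomeE:
  assumes "interval_system S I" "J_pivot S I V h = Some v"
  obtains j where "j \<in> J_procedure S I" "v = lowest S j" | "V = Some v"
proof (cases "List.find (\<lambda>j. h \<inter> j \<noteq> {lowest S j}) (J_list S I)")
  case None
  then show ?thesis using assms that by (simp add: J_pivot_def)
next
  case (Some j)
  then have "j \<in> set (J_list S I)" by (auto simp: find_Some_iff)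
  then show ?thesis using Some assms that(1)[of j] by (simp add: J_pivot_def set_J_list)
qed

context
  fixes S :: "'a::{finite, order} set" and I j \<rho>
  assumes sys: "interval_system S I" and ne: "I \<noteq> {}"
    and j_def: "j = first_interval S I" and rho_def: "\<rho> = lowest S j"
begin

text \<open>A vertex of \<open>h\<close> cut off from an interval would lie in
  \<open>j - {\<rho>}\<close>, which \<open>h\<close> avoids, so truncation loses nothing.
  Conversely, \<open>j\<close> is met in \<open>\<rho>\<close>, and each other interval contains one
  of the next system.\<close>

lemma transversals_next:
  assumes hj: "h \<inter> j = {\<rho>}"
  shows "h \<in> transversals S I \<longleftrightarrow> h \<in> transversals S (next_system S I)"
proof
  assume h: "h \<in> transversals S I"
  have "h \<inter> B \<noteq> {}" if B: "B \<in> next_system S I" for B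
  proof -
    obtain A where A: "A \<in> I" "A \<noteq> j" "B = {x \<in> A. \<forall>w\<in>j. w < x}"
      using B by (rule next_systemE[OF sys ne j_def rho_def])
    obtain x where x: "x \<in> h" "x \<in> A" using h A(1) by (auto simp: transversals_def)
    have "\<forall>w\<in>j. w < x"
      using not_truncated[OF sys ne j_def rho_def A(1,2) x(2)] hj x(1) by blast
    then show ?thesis using x A(3) by blast
  qed
  then show "h \<in> transversals S (next_system S I)" using h by (simp add: transversals_def)
next
  assume h: "h \<in> transversals S (next_system S I)"
  have "h \<inter> A \<noteq> {}" if A: "A \<in> I" for A
  proof (cases "A = j")
    case True
    then show ?thesis using hj by simp
  next
    case False
    obtain B where "B \<in> next_system S I" "B \<subseteq> A"
      using A False by (rule next_system_below[OF sys ne j_def rho_def])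
    then show ?thesis using h unfolding transversals_def by blast
  qed
  then show "h \<in> transversals S I" using h by (simp add: transversals_def)
qed

text \<open>Since \<open>h\<close> meets \<open>j\<close>, but not exactly in \<open>\<rho>\<close>,
  it contains another vertex of \<open>j\<close>, which survives the toggle. The other intervals do
  not contain \<open>\<rho>\<close>.\<close>

lemma transversals_toggle_first:
  assumes h: "h \<in> transversals S I" and hj: "h \<inter> j \<noteq> {\<rho>}"
  shows "toggle \<rho> h \<in> transversals S I" "toggle \<rho> h \<inter> j \<noteq> {\<rho>}"
proof -
  note fr = first_rho[OF sys ne j_def rho_def] and fi = first_in[OF sys ne j_def rho_def]
  have hS: "h \<subseteq> S" and meets: "\<And>A. A \<in> I \<Longrightarrow> h \<inter> A \<noteq> {}"
    using h by (auto simp: transversals_def)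
  obtain y where y: "y \<in> h" "y \<in> j" "y \<noteq> \<rho>"
    using meets[OF fi] hj by blast
  then have yt: "y \<in> toggle \<rho> h" by (auto simp: toggle_def)
  then show "toggle \<rho> h \<inter> j \<noteq> {\<rho>}" using y by blast
  have "toggle \<rho> h \<inter> A \<noteq> {}" if A: "A \<in> I" for A
  proof (cases "A = j")
    case False
    obtain x where x: "x \<in> h" "x \<in> A" using meets[OF A] by blast
    then have "x \<noteq> \<rho>" using rho_less[OF sys ne j_def rho_def A False x(2)] by blast
    then have "x \<in> toggle \<rho> h" using x(1) by (auto simp: toggle_def)
    then show ?thesis using x by blast
  qed (use y yt in blast)
  moreover have "\<rho> \<in> S" using fr(1) interval_systemD(3)[OF sys fi] by blast
  ultimately show "toggle \<rho> h \<in> transversals S I"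
    using hS by (auto simp: transversals_def toggle_def)
qed

text \<open>Ensures that toggling a later pivot leaves \<open>h \<inter> j\<close> alone: such a
  pivot lies in an interval above \<open>j\<close>, or it comes from \<open>V\<close> and is outside
  all of J.\<close>

lemma J_pivot_next_notin_first:
  assumes V: "\<And>v. V = Some v \<Longrightarrow> v \<notin> \<Union>(J_procedure S I)"
    and v: "J_pivot S (next_system S I) V h = Some v"
  shows "v \<notin> j"
proof -
  note nxt = interval_system_next[OF sys ne j_def rho_def]
  show ?thesis
    using nxt v
  proof (cases rule: J_pivot_SomeE)
    case (1 B)
    have "lowest S B \<in> B"
      using lowest_props(1)[OF interval_systemD(1)[OF sys]] J_procedure_within(1,2)[OF nxt 1(1)] by blast
    then show ?thesis using J_procedure_above[OF sys ne j_def 1(1)] 1(2) by blast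
  next
    case 2
    then show ?thesis using V J_procedure_next[OF ne, of S] j_def by auto
  qed
qed

end

text \<open>Toggling the pivot does not change whether \<open>h \<inter> j = {\<rho>}\<close>. If
  this fails, the pivot is \<open>\<rho>\<close>; if it holds, the pivot lies outside
  \<open>j\<close> and the induction hypothesis applies.\<close>

lemma toggle_closed_J_pivot:
  fixes S :: "'a::{finite, order} set"
  assumes "interval_system S I"
    and "\<And>v. V = Some v \<Longrightarrow> v \<in> S - \<Union>(J_procedure S I)"
  shows "toggle_closed (transversals S I) (J_pivot S I V)"
  using assms
proof (induction S I rule: J_procedure.induct)
  case (1 S I)
  note V = 1(3)
  show ?case
  proof (cases "I = {}")
    case True
    then show ?thesis using V by (auto simp: toggle_closed_def transversals_def toggle_def)
  next
    case False
    define j where "j = first_interval S I"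
    define \<rho> where "\<rho> = lowest S j"
    note ctx = 1(2) False j_def \<rho>_def
    have IH: "toggle_closed (transversals S (next_system S I)) (J_pivot S (next_system S I) V)"
      using 1(1)[OF False] interval_system_next[OF ctx] V J_procedure_next[OF False, of S]
      by (simp add: next_system_def)
    show ?thesis
      unfolding toggle_closed_def
    proof (intro ballI allI impI)
      fix h v assume h: "h \<in> transversals S I" and v: "J_pivot S I V h = Some v"
      show "toggle v h \<in> transversals S I \<and> J_pivot S I V (toggle v h) = Some v"
      proof (cases "h \<inter> j = {\<rho>}")
        case True
        then have v': "J_pivot S (next_system S I) V h = Some v"
          using v J_pivot_next[OF ctx] by simp
        then have "v \<notin> j" using J_pivot_next_notin_first[OF ctx] V by blast
        then have "toggle v h \<inter> j = {\<rho>}" using True by (auto simp: toggle_def)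
        then show ?thesis
          using toggle_closedD[OF IH _ v'] h True transversals_next[OF ctx] J_pivot_next[OF ctx] by simp
      next
        case False
        then show ?thesis
          using v transversals_toggle_first[OF ctx h False] J_pivot_next[OF ctx] by simp
      qed
    qed
  qed
qed

lemma acyclic_J_pivot:
  fixes S :: "'a::{finite, order} set"
  assumes "interval_system S I"
    and "\<And>v. V = Some v \<Longrightarrow> v \<in> S - \<Union>(J_procedure S I)"
  shows "acyclic (toggle_graph (transversals S I) (J_pivot S I V))"
  using assms
proof (induction S I rule: J_procedure.induct)
  case (1 S I)
  note V = 1(3)
  show ?case
  proof (cases "I = {}")
    case True
    then show ?thesis by (simp add: acyclic_toggle_graph_const)
  next
    case False
    define j where "j = first_interval S I"
    define \<rho> where "\<rho> = lowest S j"
    note ctx = 1(2) False j_def \<rho>_def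
    define D where "D = transversals S I"
    define D' where "D' = transversals S (next_system S I)"
    define f where "f = J_pivot S I V"
    define f' where "f' = J_pivot S (next_system S I) V"
    have f: "f h = (if h \<inter> j \<noteq> {\<rho>} then Some \<rho> else f' h)" for h
      unfolding f_def f'_def by (rule J_pivot_next[OF ctx])
    have D': "h \<in> D \<longleftrightarrow> h \<in> D'" if "h \<inter> j = {\<rho>}" for h
      unfolding D_def D'_def using that by (rule transversals_next[OF ctx])
    have f'_j: "v \<notin> j" if "f' h = Some v" for h v
      using J_pivot_next_notin_first[OF ctx] V that unfolding f'_def by blast
    have IH: "acyclic (toggle_graph D' f')"
      using 1(1)[OF False] interval_system_next[OF ctx] V J_procedure_next[OF False, of S]
      by (simp add: next_system_def D'_def f'_def)
    \<comment> \<open>Level 0 consists of the faces handed on to the next system; on level 1 the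
      pivot is constantly \<open>\<rho>\<close>.\<close>
    define l :: "'a set \<Rightarrow> nat" where "l h = (if h \<inter> j = {\<rho>} then 0 else 1)" for h
    \<comment> \<open>An upward edge inserts a pivot outside \<open>j\<close>. A downward edge
      deleting \<open>\<rho>\<close> would leave \<open>j\<close> unmet, so its target would not be
      a transversal.\<close>
    have stay: "b \<inter> j = {\<rho>}" if "(a, b) \<in> toggle_graph D f" "a \<inter> j = {\<rho>}" for a b
      using that(1)
    proof (cases rule: toggle_graphE)
      case (up v)
      then show ?thesis using f'_j[of a v] that(2) f by auto
    next
      case (down x)
      have "b \<inter> j \<noteq> {}"
        using down(2) first_in[OF ctx] by (auto simp: D_def transversals_def)
      then show ?thesis using down(5) that(2) by blast
    qed
    have "acyclic (toggle_graph D f)"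
    proof (rule acyclic_by_levels)
      show "(a, b) \<in> toggle_graph D f \<Longrightarrow> l b \<le> l a" for a b
        using stay by (auto simp: l_def)
      fix n
      let ?R = "{(a, b) \<in> toggle_graph D f. l a = n \<and> l b = n}"
      show "acyclic ?R"
      proof (cases "n = 0")
        case True
        have "?R \<subseteq> toggle_graph D' f'"
        proof (rule subrelI)
          fix a b assume "(a, b) \<in> ?R"
          then have ab: "(a, b) \<in> toggle_graph D f" and "a \<inter> j = {\<rho>}" "b \<inter> j = {\<rho>}"
            using True by (auto simp: l_def split: if_splits)
          then have "f a = f' a" "a \<in> D \<longleftrightarrow> a \<in> D'" "b \<in> D \<longleftrightarrow> b \<in> D'" using f D' by auto
          with ab show "(a, b) \<in> toggle_graph D' f'"
            by (auto elim!: toggle_graphE intro: toggle_graph_upI toggle_graph_downI)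
        qed
        then show ?thesis using IH acyclic_subset by blast
      next
        case False
        have "?R \<subseteq> toggle_graph D (\<lambda>_. Some \<rho>)"
        proof (rule subrelI)
          fix a b assume "(a, b) \<in> ?R"
          then have ab: "(a, b) \<in> toggle_graph D f" and "a \<inter> j \<noteq> {\<rho>}"
            using False by (auto simp: l_def split: if_splits)
          then have "f a = Some \<rho>" using f by simp
          with ab show "(a, b) \<in> toggle_graph D (\<lambda>_. Some \<rho>)"
            by (auto elim!: toggle_graphE intro: toggle_graph_upI toggle_graph_downI)
        qed
        then show ?thesis using acyclic_toggle_graph_const acyclic_subset by blast
      qed
    qed
    then show ?thesis by (simp add: D_def f_def)
  qed
qed

section \<open>Facets and lexicographic orders\<close>

lemma facetD:
  assumes "S \<in> facets"
  shows "S \<subseteq> - {bot, top}" "Complete_Partial_Order.chain (\<le>) S"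
  using assms by (auto simp: maximal_faces_def order_complex_def)

lemma facet_linear:
  assumes "S \<in> facets" "x \<in> S" "y \<in> S"
  shows "x \<le> y \<or> y \<le> x"
  using facetD(2)[OF assms(1)] assms(2,3) unfolding Complete_Partial_Order.chain_def by blast

lemma facet_memI:
  assumes S: "S \<in> facets" and w: "w \<notin> {bot, top}" and cmp: "\<And>x. x \<in> S \<Longrightarrow> x \<le> w \<or> w \<le> x"
  shows "w \<in> S"
proof -
  have "insert w S \<in> order_complex"
    using facetD[OF S] w cmp unfolding order_complex_def Complete_Partial_Order.chain_def by auto
  then have "insert w S = S" using S unfolding maximal_faces_def by blast
  then show ?thesis by blast
qed

lemma facetI:
  assumes S: "S \<subseteq> - {bot, top}" "\<And>x y. x \<in> S \<Longrightarrow> y \<in> S \<Longrightarrow> x \<le> y \<or> y \<le> x"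
    and mx: "\<And>w. w \<notin> {bot, top} \<Longrightarrow> (\<And>x. x \<in> S \<Longrightarrow> x \<le> w \<or> w \<le> x) \<Longrightarrow> w \<in> S"
  shows "S \<in> facets"
proof -
  have "S \<in> order_complex"
    using S unfolding order_complex_def Complete_Partial_Order.chain_def by blast
  moreover have "T \<subseteq> S" if T: "T \<in> order_complex" "S \<subseteq> T" for T
  proof
    fix w assume "w \<in> T"
    then show "w \<in> S"
      using T unfolding order_complex_def Complete_Partial_Order.chain_def by (intro mx) blast+
  qed
  ultimately show ?thesis unfolding maximal_faces_def by blast
qed

lemma facet_subset_eq:
  assumes "S \<in> facets" "T \<in> facets" "S \<subseteq> T"
  shows "S = T"
  using assms unfolding maximal_faces_def by blast

text \<open>The chain follows \<open>S\<close> strictly below \<open>Z\<close> and \<open>T\<close>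
  from the least element of \<open>Z\<close> on; for empty \<open>Z\<close> it is \<open>S\<close>.
  A vertex comparable with all of it is comparable with all of \<open>S\<close> or all of
  \<open>T\<close>, because elements of \<open>Z\<close> separate it from the discarded part;
  maximality of \<open>S\<close> or \<open>T\<close> then applies.\<close>

lemma splice_facets:
  assumes S: "S \<in> facets" and T: "T \<in> facets" and Z: "Z \<subseteq> S \<inter> T"
  shows "{v \<in> S. \<forall>z\<in>Z. v < z} \<union> {v \<in> T. \<exists>z\<in>Z. z \<le> v} \<in> facets" (is "?L \<union> ?U \<in> _")
proof (rule facetI)
  show "?L \<union> ?U \<subseteq> - {bot, top}" using facetD(1) S T by blast
  have LU: "x \<le> y" if "x \<in> ?L" "y \<in> ?U" for x y
    using that by (auto intro: less_imp_le less_le_trans)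
  show "x \<le> y \<or> y \<le> x" if "x \<in> ?L \<union> ?U" "y \<in> ?L \<union> ?U" for x y
    using that LU facet_linear[OF S, of x y] facet_linear[OF T, of x y] by blast
  fix w assume w: "w \<notin> {bot, top}" and cmp: "\<And>x. x \<in> ?L \<union> ?U \<Longrightarrow> x \<le> w \<or> w \<le> x"
  show "w \<in> ?L \<union> ?U"
  proof (cases "\<forall>z\<in>Z. w < z")
    case True
    have "w \<in> S"
    proof (rule facet_memI[OF S w])
      fix x assume x: "x \<in> S"
      show "x \<le> w \<or> w \<le> x"
      proof (cases "x \<in> ?L")
        case False
        then obtain z where z: "z \<in> Z" "\<not> x < z" using x by blast
        then have "z \<le> x" using facet_linear[OF S x, of z] Z by (auto simp: less_le)
        moreover have "w < z" using True z by blast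
        ultimately show ?thesis by auto
      qed (use cmp in blast)
    qed
    then show ?thesis using True by blast
  next
    case False
    then obtain z where z: "z \<in> Z" "\<not> w < z" by blast
    have "z \<in> ?U" using z Z by blast
    then have zw: "z \<le> w" using cmp[of z] z(2) by (auto simp: less_le)
    have "w \<in> T"
    proof (rule facet_memI[OF T w])
      fix x assume x: "x \<in> T"
      show "x \<le> w \<or> w \<le> x"
      proof (cases "x \<in> ?U")
        case False
        then have "x \<le> z" using x z facet_linear[OF T x, of z] Z by blast
        then show ?thesis using zw by auto
      qed (use cmp in blast)
    qed
    then show ?thesis using z zw by blast
  qed
qed

lemma facet_least_difference:
  assumes S: "S \<in> facets" and T: "T \<in> facets" and ne: "S \<noteq> T"
  obtains x where "x \<in> S" "x \<notin> T" "\<And>w. w \<in> S \<Longrightarrow> w < x \<Longrightarrow> w \<in> T"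
proof -
  have "S - T \<noteq> {}" using facet_subset_eq[OF S T] ne by blast
  then obtain x where x: "x \<in> S - T" "\<forall>w\<in>S - T. w \<le> x \<longrightarrow> x = w"
    using finite_has_minimal[of "S - T"] by auto
  show thesis
  proof (rule that)
    show "w \<in> T" if "w \<in> S" "w < x" for w
      using x(2) that by (auto simp: less_le)
  qed (use x(1) in auto)
qed

text \<open>Were \<open>y \<le> w\<close> for such a \<open>w\<close>, then \<open>y\<close> would
  be comparable with all of \<open>S\<close>: elements below \<open>x\<close> lie in the chain
  \<open>T\<close>, the others are above \<open>w\<close>. Maximality would put \<open>y\<close>
  into \<open>S\<close>. Used in both directions, this shows that two facets agree below their first
  differences.\<close>

lemma facet_below_difference:
  assumes S: "S \<in> facets" and T: "T \<in> facets"
    and x: "x \<in> S" "x \<notin> T" "\<And>w. w \<in> S \<Longrightarrow> w < x \<Longrightarrow> w \<in> T"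
    and y: "y \<in> T" "y \<notin> S" "\<And>w. w \<in> T \<Longrightarrow> w < y \<Longrightarrow> w \<in> S"
  shows "{w \<in> S. w < x} \<subseteq> {w \<in> T. w < y}"
proof
  fix w assume w: "w \<in> {w \<in> S. w < x}"
  then have wT: "w \<in> T" using x(3) by blast
  have "\<not> y \<le> w"
  proof
    assume yw: "y \<le> w"
    have "y \<in> S"
    proof (rule facet_memI[OF S])
      show "y \<notin> {bot, top}" using facetD(1)[OF T] y(1) by blast
      fix u assume u: "u \<in> S"
      show "u \<le> y \<or> y \<le> u"
      proof (cases "u < x")
        case True
        then show ?thesis using x(3)[OF u] facet_linear[OF T _ y(1)] by blast
      next
        case False
        then have "x \<le> u" using facet_linear[OF S u x(1)] by (auto simp: less_le)
        moreover have "w \<le> x" using w by auto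
        ultimately show ?thesis using yw by (meson order.trans)
      qed
    qed
    then show False using y(2) by blast
  qed
  then show "w \<in> {w \<in> T. w < y}" using wT facet_linear[OF T wT y(1)] by (auto simp: less_le)
qed

lemma bottom_part_rank:
  fixes S :: "'a::{finite, order} set"
  assumes S: "Complete_Partial_Order.chain (\<le>) S" and y: "y \<in> S"
  shows "bottom_part S (card {w \<in> S. w < y}) = {w \<in> S. w < y}"
    and "bottom_part S (card {w \<in> S. w < y} + 1) = {w \<in> S. w \<le> y}"
proof -
  have "{w \<in> S. w \<le> y} = insert y {w \<in> S. w < y}" using y by auto
  then have r: "rank_in S y = card {w \<in> S. w < y} + 1" by (simp add: rank_in_def)
  show "bottom_part S (card {w \<in> S. w < y}) = {w \<in> S. w < y}"
    using rank_in_less_iff[OF S _ y] r by (auto simp: bottom_part_def less_Suc_eq_le)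
  show "bottom_part S (card {w \<in> S. w < y} + 1) = {w \<in> S. w \<le> y}"
    using rank_in_le_iff[OF S _ y] r by (auto simp: bottom_part_def)
qed

section \<open>Minimal skipped intervals of a lexicographic order\<close>

context
  fixes F :: "nat \<Rightarrow> 'a::{finite, order_bot, order_top} set" and N :: nat
  assumes lex: "lexicographic_order F N"
begin

lemma F_facet: "k \<in> {1..N} \<Longrightarrow> F k \<in> facets"
  using lex by (auto simp: lexicographic_order_def bij_betw_def)

lemma F_inj: "i \<in> {1..N} \<Longrightarrow> k \<in> {1..N} \<Longrightarrow> F i = F k \<Longrightarrow> i = k"
  using lex by (auto simp: lexicographic_order_def bij_betw_def dest: inj_onD)

lemma F_surj:
  assumes "S \<in> facets"
  shows "\<exists>k\<in>{1..N}. S = F k"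
proof -
  have "F ` {1..N} = facets" using lex by (simp add: lexicographic_order_def bij_betw_def)
  then show ?thesis using assms by blast
qed

text \<open>
  Follow \<open>F i\<close> from the first rank at which it differs from \<open>F k\<close> until it meets \<open>F k\<close> again,
  and \<open>F k\<close> from there on: this facet precedes \<open>F k\<close> by the lexicographic condition.
\<close>
lemma earlier_facet_skipping_interval:
  assumes i: "i \<in> {1..N}" and k: "k \<in> {1..N}" and ik: "i < k"
  shows "\<exists>c\<in>{1..<k}. F i \<inter> F k \<subseteq> F c \<and>
    (\<forall>x\<in>F k - F c. \<forall>y\<in>F k - F c. \<forall>z\<in>F k. x \<le> z \<and> z \<le> y \<longrightarrow> z \<in> F k - F c)"
proof -
  note Fi = F_facet[OF i] and Fk = F_facet[OF k]
  have "F i \<noteq> F k" using F_inj[OF i k] ik by blast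
  then obtain x y where x: "x \<in> F i" "x \<notin> F k" "\<And>w. w \<in> F i \<Longrightarrow> w < x \<Longrightarrow> w \<in> F k"
    and y: "y \<in> F k" "y \<notin> F i" "\<And>w. w \<in> F k \<Longrightarrow> w < y \<Longrightarrow> w \<in> F i"
    using facet_least_difference[OF Fi Fk] facet_least_difference[OF Fk Fi] by metis
  have B: "{w \<in> F i. w < x} = {w \<in> F k. w < y}"
    using facet_below_difference[OF Fi Fk x y] facet_below_difference[OF Fk Fi y x] by blast
  \<comment> \<open>The facets agree at the ranks up to \<open>p\<close> and differ at rank
    \<open>p + 1\<close>, where they have \<open>x\<close> and \<open>y\<close>.\<close>
  define p where "p = card {w \<in> F k. w < y}"
  note bi = bottom_part_rank[OF facetD(2)[OF Fi] x(1), unfolded B, folded p_def]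
  note bk = bottom_part_rank[OF facetD(2)[OF Fk] y(1), folded p_def]
  \<comment> \<open>The common vertices at which \<open>F k\<close> can be resumed. If there are
    none, \<open>G\<close> is \<open>F i\<close>.\<close>
  define Z where "Z = {z \<in> F i \<inter> F k. y < z}"
  define G where "G = {v \<in> F i. \<forall>z\<in>Z. v < z} \<union> {v \<in> F k. \<exists>z\<in>Z. z \<le> v}"
  have "G \<in> facets"
    unfolding G_def by (rule splice_facets[OF Fi Fk]) (auto simp: Z_def)
  then obtain c where c: "c \<in> {1..N}" "G = F c" using F_surj by blast
  have bG: "bottom_part (F i) (p + 1) \<subseteq> F c"
  proof
    fix w assume "w \<in> bottom_part (F i) (p + 1)"
    then have w: "w \<in> F i" "w \<le> x" using bi(2) by auto
    \<comment> \<open>The points of return also lie above \<open>x\<close>, since below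
      \<open>x\<close> the facet \<open>F i\<close> has only the elements of \<open>F k\<close>
      below \<open>y\<close>.\<close>
    have "w < z" if z: "z \<in> Z" for z
    proof -
      have "\<not> z < x"
      proof
        assume "z < x"
        then have "z \<in> {w \<in> F k. w < y}" using z B unfolding Z_def by blast
        then show False using z by (auto simp: Z_def)
      qed
      moreover have "z \<noteq> x" using z x(2) by (auto simp: Z_def)
      ultimately have "x < z" using facet_linear[OF Fi x(1), of z] z by (auto simp: Z_def less_le)
      then show ?thesis using w(2) by simp
    qed
    then show "w \<in> F c" using w c by (auto simp: G_def)
  qed
  have "c < k"
  proof -
    have eq: "bottom_part (F i) p = bottom_part (F k) p" using bi bk by simp
    have "x \<in> bottom_part (F i) (p + 1)" using bi(2) x(1) by simp
    moreover have "x \<notin> bottom_part (F k) (p + 1)" using x(2) by (simp add: bottom_part_def)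
    ultimately have neq: "bottom_part (F i) (p + 1) \<noteq> bottom_part (F k) (p + 1)" by blast
    have "bottom_part (F k) (p + 1) \<subseteq> F k" by (auto simp: bottom_part_def)
    \<comment> \<open>The lexicographic condition is applied with \<open>F k\<close> itself as the
      second extending facet.\<close>
    then show ?thesis
      using lex i k c(1) ik eq neq bG unfolding lexicographic_order_def by blast
  qed
  \<comment> \<open>The skipped vertices are those of \<open>F k\<close> from \<open>y\<close> up to
    just below the first return, which makes their convexity evident.\<close>
  have skip: "F k - F c = {v \<in> F k. y \<le> v \<and> (\<forall>z\<in>Z. v < z)}"
  proof (intro equalityI subsetI)
    fix v assume v: "v \<in> F k - F c"
    have above: "v < z" if "z \<in> Z" for z
      using v that facet_linear[OF Fk, of v z] unfolding c(2)[symmetric] G_def Z_def less_le by blast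
    then have "v \<notin> F i" using v unfolding c(2)[symmetric] G_def by blast
    then have "y \<le> v" using y(3)[of v] facet_linear[OF Fk y(1), of v] v by (auto simp: less_le)
    then show "v \<in> {v \<in> F k. y \<le> v \<and> (\<forall>z\<in>Z. v < z)}" using v above by blast
  next
    fix v assume v: "v \<in> {v \<in> F k. y \<le> v \<and> (\<forall>z\<in>Z. v < z)}"
    have "v \<notin> F i"
    proof
      assume "v \<in> F i"
      then have "v \<in> Z" using v y(2) by (auto simp: Z_def less_le)
      then show False using v by auto
    qed
    moreover have "\<not> z \<le> v" if "z \<in> Z" for z using v that by (auto simp: less_le_not_le)
    ultimately show "v \<in> F k - F c" using v c(2) by (auto simp: G_def)
  qed
  have "F i \<inter> F k \<subseteq> F c"
  proof
    fix v assume v: "v \<in> F i \<inter> F k"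
    have "v \<notin> {v \<in> F k. y \<le> v \<and> (\<forall>z\<in>Z. v < z)}"
      using v y(2) by (auto simp: Z_def less_le)
    then show "v \<in> F c" using v skip by blast
  qed
  moreover have "(\<forall>x\<in>F k - F c. \<forall>y\<in>F k - F c. \<forall>z\<in>F k. x \<le> z \<and> z \<le> y \<longrightarrow> z \<in> F k - F c)"
    unfolding skip by (auto intro: order.trans le_less_trans)
  moreover have "c \<in> {1..<k}" using \<open>c < k\<close> c(1) by simp
  ultimately show ?thesis by blast
qed

text \<open>A maximal old face \<open>G\<close> lies in some earlier \<open>F i\<close>, hence in
  \<open>F c \<inter> F k\<close> for an earlier \<open>F c\<close> that skips a single interval.
  That intersection is an old face too, so it equals \<open>G\<close> by maximality.\<close>

lemma I_interval_eq:
  assumes k: "k \<in> {1..N}" and A: "A \<in> I_intervals F k"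
  shows "\<exists>c\<in>{1..<k}. A = F k - F c \<and> (\<forall>x\<in>A. \<forall>y\<in>A. \<forall>z\<in>F k. x \<le> z \<and> z \<le> y \<longrightarrow> z \<in> A)"
proof -
  obtain G where G: "A = F k - G" "G \<in> old_faces F k"
    and mx: "\<And>H. H \<in> old_faces F k \<Longrightarrow> G \<subseteq> H \<Longrightarrow> H = G"
    using A unfolding I_intervals_def maximal_faces_def by auto
  obtain i where i: "i \<in> {1..<k}" "G \<subseteq> F i" "G \<subseteq> F k"
    using G(2) unfolding old_faces_def by blast
  then have iN: "i \<in> {1..N}" and ik: "i < k" using k by auto
  obtain c where c: "c \<in> {1..<k}" "F i \<inter> F k \<subseteq> F c"
    and conv: "(\<forall>x\<in>F k - F c. \<forall>y\<in>F k - F c. \<forall>z\<in>F k. x \<le> z \<and> z \<le> y \<longrightarrow> z \<in> F k - F c)"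
    using earlier_facet_skipping_interval[OF iN k ik] by (elim bexE conjE)
  have "F c \<inter> F k \<in> old_faces F k" using c(1) unfolding old_faces_def by blast
  then have "F c \<inter> F k = G" using mx i c(2) by blast
  then have A: "A = F k - F c" using G(1) by blast
  show ?thesis unfolding A by (rule bexI[where x = c], intro conjI refl conv, rule c(1))
qed

lemma interval_system_I_intervals:
  assumes k: "k \<in> {1..N}"
  shows "interval_system (F k) (I_intervals F k)"
  unfolding interval_system_def
proof (intro conjI ballI impI)
  show "Complete_Partial_Order.chain (\<le>) (F k)" by (rule facetD[OF F_facet[OF k]])
next
  fix A assume A: "A \<in> I_intervals F k"
  obtain c where c: "c \<in> {1..<k}" "A = F k - F c"
    and conv: "(\<forall>x\<in>A. \<forall>y\<in>A. \<forall>z\<in>F k. x \<le> z \<and> z \<le> y \<longrightarrow> z \<in> A)"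
    using I_interval_eq[OF k A] by blast
  have "c \<in> {1..N}" using c(1) k by simp
  then have "F k \<noteq> F c" using F_inj[OF k, of c] c(1) by auto
  then show "A \<noteq> {}"
    using facet_subset_eq[OF F_facet[OF k] F_facet[OF \<open>c \<in> {1..N}\<close>]] c(2) by blast
  show "A \<subseteq> F k" using c(2) by blast
  show "z \<in> A" if "x \<in> A" "y \<in> A" "z \<in> F k" "x \<le> z \<and> z \<le> y" for x y z
    using conv that by blast
  show "A = B" if B: "B \<in> I_intervals F k" and AB: "A \<subseteq> B" for B
  proof -
    obtain G where G: "A = F k - G" "G \<in> old_faces F k"
      and mx: "\<And>H. H \<in> old_faces F k \<Longrightarrow> G \<subseteq> H \<Longrightarrow> H = G"
      using A unfolding I_intervals_def maximal_faces_def by auto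
    obtain H where H: "B = F k - H" "H \<in> old_faces F k"
      and mxH: "\<And>G. G \<in> old_faces F k \<Longrightarrow> H \<subseteq> G \<Longrightarrow> G = H"
      using B unfolding I_intervals_def maximal_faces_def by auto
    \<comment> \<open>Passing to complements reverses inclusion, so maximality of \<open>H\<close>
      yields equality.\<close>
    have "H \<subseteq> G" using AB G H unfolding old_faces_def by blast
    then show ?thesis using mxH[OF G(2)] G(1) H(1) by simp
  qed
qed

end

text \<open>By finiteness an old face lies in an inclusion-maximal old face, and lying in it means
  being disjoint from its complement in \<open>F k\<close>.\<close>

lemma new_faces_eq_transversals:
  fixes F :: "nat \<Rightarrow> 'a::finite set"
  shows "new_faces F k = transversals (F k) (I_intervals F k)"
proof -
  have "(\<exists>i\<in>{1..<k}. h \<subseteq> F i) \<longleftrightarrow> (\<exists>A\<in>I_intervals F k. h \<inter> A = {})" if h: "h \<subseteq> F k" for h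
  proof
    assume "\<exists>i\<in>{1..<k}. h \<subseteq> F i"
    then have "h \<in> old_faces F k" using h by (simp add: old_faces_def)
    then obtain G where "G \<in> old_faces F k" "h \<subseteq> G" "\<forall>H\<in>old_faces F k. G \<subseteq> H \<longrightarrow> G = H"
      using finite_has_maximal2[of "old_faces F k" h] by auto
    then have "F k - G \<in> I_intervals F k" "h \<inter> (F k - G) = {}"
      unfolding I_intervals_def maximal_faces_def by auto
    then show "\<exists>A\<in>I_intervals F k. h \<inter> A = {}" by blast
  next
    assume "\<exists>A\<in>I_intervals F k. h \<inter> A = {}"
    then obtain G where "G \<in> old_faces F k" "h \<inter> (F k - G) = {}"
      unfolding I_intervals_def maximal_faces_def by auto
    then show "\<exists>i\<in>{1..<k}. h \<subseteq> F i" using h unfolding old_faces_def by blast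
  qed
  then have "(\<forall>i\<in>{1..<k}. \<not> h \<subseteq> F i) \<longleftrightarrow> (\<forall>A\<in>I_intervals F k. h \<inter> A \<noteq> {})" if "h \<subseteq> F k" for h
    using that by (simp only: bex_simps(8)[symmetric])
  then show ?thesis unfolding new_faces_def transversals_def by (intro Collect_cong conj_cong refl)
qed

text \<open>Links the definition through \<open>tau\<close> with the form on which the inductions
  over the rounds run.\<close>

lemma pivot_eq_J_pivot:
  assumes sys: "interval_system (F k) (I_intervals F k)"
  shows "pivot F k = J_pivot (F k) (I_intervals F k)
    (let U = F k - \<Union>(J_intervals F k) in if U \<noteq> {} then Some (lowest (F k) U) else None)"
    (is "_ = J_pivot _ _ ?V")
proof
  fix h
  define js where "js = J_list (F k) (I_intervals F k)"
  define P where "P j \<longleftrightarrow> h \<inter> j \<noteq> {lowest (F k) j}" for j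
  have len: "length js = card (J_intervals F k)"
    unfolding js_def J_list_def J_intervals_def using inj_on_low_rank[OF sys]
    by (simp add: length_sorted_key_list_of_set_inj_on)
  have nth: "J_nth F k i = js ! (i - 1)" for i
    by (simp add: J_nth_def js_def J_list_def J_intervals_def)
  have tau: "tau F k h = (INF i \<in> {i \<in> {1..length js}. P (js ! (i - 1))}. enat i)"
    by (simp add: tau_def len nth rho_def P_def)
  show "pivot F k h = J_pivot (F k) (I_intervals F k) ?V h"
  proof (cases "List.find P js")
    case None
    have "\<not> P (js ! (i - 1))" if "i \<in> {1..length js}" for i
    proof -
      have "js ! (i - 1) \<in> set js" using that by (intro nth_mem) auto
      then show ?thesis using None by (auto simp: find_None_iff)
    qed
    then have none: "{i \<in> {1..length js}. P (js ! (i - 1))} = {}" by blast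
    have "tau F k h = \<infinity>" unfolding tau none by (simp add: top_enat_def)
    then show ?thesis
      using None unfolding J_pivot_def js_def[symmetric] P_def[symmetric]
      by (simp add: pivot_def)
  next
    case (Some j)
    then obtain n where n: "n < length js" "P (js ! n)" "j = js ! n" "\<And>m. m < n \<Longrightarrow> \<not> P (js ! m)"
      by (auto simp: find_Some_iff)
    \<comment> \<open>Intervals are numbered from 1 and list positions from 0, hence the
      successor.\<close>
    have "tau F k h = enat (Suc n)"
      unfolding tau
    proof (rule antisym)
      show "(INF i \<in> {i \<in> {1..length js}. P (js ! (i - 1))}. enat i) \<le> enat (Suc n)"
        using n by (intro INF_lower) auto
      have "Suc n \<le> i" if "1 \<le> i" "P (js ! (i - 1))" for i
        using n(4)[of "i - 1"] that by (cases i) (auto simp: not_less[symmetric])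
      then show "enat (Suc n) \<le> (INF i \<in> {i \<in> {1..length js}. P (js ! (i - 1))}. enat i)"
        by (intro INF_greatest) auto
    qed
    then show ?thesis
      using Some n(3) unfolding J_pivot_def js_def[symmetric] P_def[symmetric]
      by (simp add: pivot_def rho_def nth)
  qed
qed

text \<open>Treats cases (i) and (ii) uniformly; in case (i) all faces share one pivot.\<close>

definition facet_pivot :: "(nat \<Rightarrow> 'a::{finite, order} set) \<Rightarrow> nat \<Rightarrow> 'a set \<Rightarrow> 'a option" where
  "facet_pivot F k =
     (let U = F k - \<Union>(I_intervals F k) in
      if U \<noteq> {} then (\<lambda>_. Some (lowest (F k) U)) else pivot F k)"

lemma facet_pivot_toggle:
  assumes sys: "interval_system (F k) (I_intervals F k)"
  shows "toggle_closed (new_faces F k) (facet_pivot F k)"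
    and "acyclic (toggle_graph (new_faces F k) (facet_pivot F k))"
    and "M_pairs F k = toggle_pairs (new_faces F k) (facet_pivot F k)"
proof -
  define U where "U = F k - \<Union>(I_intervals F k)"
  have low: "lowest (F k) W \<in> W" if "W \<subseteq> F k" "W \<noteq> {}" for W
    using lowest_props(1)[OF interval_systemD(1)[OF sys] that] .
  have "toggle_closed (new_faces F k) (facet_pivot F k) \<and>
    acyclic (toggle_graph (new_faces F k) (facet_pivot F k)) \<and>
    M_pairs F k = toggle_pairs (new_faces F k) (facet_pivot F k)"
  proof (cases "U = {}")
    case True
    have p: "facet_pivot F k = pivot F k"
      using True by (simp add: facet_pivot_def Let_def U_def[symmetric])
    have "M_pairs F k = toggle_pairs (new_faces F k) (pivot F k)"
      using True unfolding M_pairs_def toggle_pairs_def Let_def U_def[symmetric] by simp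
    \<comment> \<open>The default pivot lies outside all intervals of J, as the two inductive lemmas
      require.\<close>
    moreover have "v \<in> F k - \<Union>(J_procedure (F k) (I_intervals F k))"
      if "(let U = F k - \<Union>(J_intervals F k) in if U \<noteq> {} then Some (lowest (F k) U) else None) = Some v" for v
      using that low[of "F k - \<Union>(J_intervals F k)"]
      by (auto simp: Let_def J_intervals_def split: if_splits)
    ultimately show ?thesis
      using toggle_closed_J_pivot[OF sys] acyclic_J_pivot[OF sys]
      unfolding p pivot_eq_J_pivot[OF sys] new_faces_eq_transversals by metis
  next
    case False
    define \<rho> where "\<rho> = lowest (F k) U"
    have rho: "\<rho> \<in> U" unfolding \<rho>_def using False by (intro low) (auto simp: U_def)
    have p: "facet_pivot F k = (\<lambda>_. Some \<rho>)"
      using False by (simp add: facet_pivot_def Let_def U_def[symmetric] \<rho>_def)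
    \<comment> \<open>Here \<open>\<rho>\<close> lies in no interval, so toggling it does not affect
      which intervals are met.\<close>
    have cl: "toggle \<rho> h \<in> new_faces F k" if "h \<in> new_faces F k" for h
    proof -
      have "toggle \<rho> h \<inter> A = h \<inter> A" if "A \<in> I_intervals F k" for A
        using rho that by (auto simp: U_def toggle_def)
      moreover have "toggle \<rho> h \<subseteq> F k"
        using rho that by (auto simp: U_def toggle_def new_faces_def)
      ultimately show ?thesis
        using that unfolding new_faces_eq_transversals transversals_def by simp
    qed
    have "M_pairs F k = {{h - {\<rho>}, h} | h. h \<in> new_faces F k \<and> \<rho> \<in> h}"
      using False unfolding M_pairs_def Let_def U_def[symmetric] \<rho>_def by simp
    \<comment> \<open>\<open>M_pairs\<close> lists a pair by its member containing
      \<open>\<rho>\<close>, \<open>toggle_pairs\<close> by either member; \<open>cl\<close> shows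
      that the larger member is a new face as well.\<close>
    also have "\<dots> = toggle_pairs (new_faces F k) (\<lambda>_. Some \<rho>)"
    proof (intro equalityI subsetI)
      fix e assume "e \<in> {{h - {\<rho>}, h} | h. h \<in> new_faces F k \<and> \<rho> \<in> h}"
      then obtain h where h: "h \<in> new_faces F k" "\<rho> \<in> h" "e = {h - {\<rho>}, h}" by blast
      then have "e = {h, toggle \<rho> h}" by (simp add: toggle_def insert_commute)
      then show "e \<in> toggle_pairs (new_faces F k) (\<lambda>_. Some \<rho>)"
        using h(1) unfolding toggle_pairs_def by blast
    next
      fix e assume "e \<in> toggle_pairs (new_faces F k) (\<lambda>_. Some \<rho>)"
      then obtain h where h: "h \<in> new_faces F k" "e = {h, toggle \<rho> h}"
        unfolding toggle_pairs_def by blast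
      obtain g where "g \<in> new_faces F k" "\<rho> \<in> g" "e = {g - {\<rho>}, g}"
      proof (cases "\<rho> \<in> h")
        case True
        then show thesis using that[of h] h by (simp add: toggle_def insert_commute)
      next
        case False
        then show thesis using that[of "toggle \<rho> h"] h cl[OF h(1)] by (simp add: toggle_def)
      qed
      then show "e \<in> {{h - {\<rho>}, h} | h. h \<in> new_faces F k \<and> \<rho> \<in> h}" by blast
    qed
    finally show ?thesis
      using cl acyclic_toggle_graph_const by (simp add: p toggle_closed_def)
  qed
  then show "toggle_closed (new_faces F k) (facet_pivot F k)"
    and "acyclic (toggle_graph (new_faces F k) (facet_pivot F k))"
    and "M_pairs F k = toggle_pairs (new_faces F k) (facet_pivot F k)" by auto
qed

section \<open>Gluing the matchings of the single facets\<close>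

theorem theorem2p1:
  fixes F :: "nat \<Rightarrow> 'a::{finite, order_bot, order_top} set" and N :: nat
  assumes "lexicographic_order F N"
  shows "acyclic_matching order_complex (\<Union>k\<in>{1..N}. M_pairs F k)"
proof -
  note facet = facet_pivot_toggle[OF interval_system_I_intervals[OF assms]]
  \<comment> \<open>The index of the first facet containing \<open>h\<close>. By \<open>new\<close>
    below, the faces of level \<open>k\<close> are the new faces of \<open>F k\<close>, so the
    pivots of the facets combine into one function \<open>f\<close>.\<close>
  define l where "l h = (LEAST k. k \<in> {1..N} \<and> h \<subseteq> F k)" for h
  define f where "f h = facet_pivot F (l h) h" for h
  have down: "h \<in> order_complex" if "h \<subseteq> g" "g \<in> order_complex" for h g :: "'a set"
    using that unfolding order_complex_def Complete_Partial_Order.chain_def by blast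
  have l: "l h \<in> {1..N}" "h \<subseteq> F (l h)" if h: "h \<in> order_complex" for h
  proof -
    obtain G where "G \<in> order_complex" "h \<subseteq> G" "\<forall>H\<in>order_complex. G \<subseteq> H \<longrightarrow> G = H"
      using finite_has_maximal2[of "order_complex :: 'a set set" h] h by auto
    then have "G \<in> facets" unfolding maximal_faces_def by auto
    then obtain k where "k \<in> {1..N}" "G = F k" using F_surj[OF assms] by blast
    then have "k \<in> {1..N} \<and> h \<subseteq> F k" using \<open>h \<subseteq> G\<close> by simp
    then have "l h \<in> {1..N} \<and> h \<subseteq> F (l h)" unfolding l_def by (rule LeastI)
    then show "l h \<in> {1..N}" "h \<subseteq> F (l h)" by auto
  qed
  have l_le: "l h \<le> k" if "k \<in> {1..N}" "h \<subseteq> F k" for h k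
    unfolding l_def using that by (intro Least_le) auto
  have new: "h \<in> new_faces F k \<longleftrightarrow> h \<in> order_complex \<and> l h = k" if k: "k \<in> {1..N}" for h k
  proof
    assume h: "h \<in> new_faces F k"
    have "F k \<in> order_complex" using F_facet[OF assms k] by (simp add: maximal_faces_def)
    then have hC: "h \<in> order_complex" using h down by (auto simp: new_faces_def)
    moreover have "l h \<le> k" using l_le k h by (simp add: new_faces_def)
    moreover have "\<not> l h < k" using h l[OF hC] by (auto simp: new_faces_def)
    ultimately show "h \<in> order_complex \<and> l h = k" by simp
  next
    assume h: "h \<in> order_complex \<and> l h = k"
    have "\<not> h \<subseteq> F i" if "i \<in> {1..<k}" for i
      using l_le[of i h] h that k by auto
    then show "h \<in> new_faces F k" using h l(2) by (auto simp: new_faces_def)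
  qed
  have closed: "toggle_closed order_complex f"
    unfolding toggle_closed_def
  proof (intro ballI allI impI)
    fix h v assume h: "h \<in> order_complex" "f h = Some v"
    have k: "l h \<in> {1..N}" and hn: "h \<in> new_faces F (l h)" using l new h(1) by auto
    have "toggle v h \<in> new_faces F (l h)" "facet_pivot F (l h) (toggle v h) = Some v"
      using toggle_closedD[OF facet(1)[OF k] hn] h(2) by (auto simp: f_def)
    then show "toggle v h \<in> order_complex \<and> f (toggle v h) = Some v"
      using new[OF k] by (simp add: f_def)
  qed
  have M: "(\<Union>k\<in>{1..N}. M_pairs F k) = toggle_pairs order_complex f"
  proof (intro equalityI subsetI)
    fix e assume "e \<in> (\<Union>k\<in>{1..N}. M_pairs F k)"
    then obtain k where k: "k \<in> {1..N}" "e \<in> M_pairs F k" by blast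
    then obtain h v where "h \<in> new_faces F k" "facet_pivot F k h = Some v" "e = {h, toggle v h}"
      unfolding facet(3)[OF k(1)] toggle_pairs_def by blast
    then show "e \<in> toggle_pairs order_complex f"
      using new[OF k(1)] by (auto simp: toggle_pairs_def f_def)
  next
    fix e assume "e \<in> toggle_pairs order_complex f"
    then obtain h v where h: "h \<in> order_complex" "f h = Some v" "e = {h, toggle v h}"
      unfolding toggle_pairs_def by blast
    have k: "l h \<in> {1..N}" and "h \<in> new_faces F (l h)" using l new h(1) by auto
    then have "e \<in> M_pairs F (l h)"
      using h unfolding facet(3)[OF k] toggle_pairs_def f_def by blast
    then show "e \<in> (\<Union>k\<in>{1..N}. M_pairs F k)" using k by blast
  qed
  have "acyclic (toggle_graph order_complex f)"
  proof (rule acyclic_by_levels)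
    fix a b assume ab: "(a, b) \<in> toggle_graph order_complex f"
    \<comment> \<open>An upward edge joins two new faces of the same facet; the target of a downward
      edge still lies in every facet containing \<open>a\<close>.\<close>
    then show "l b \<le> l a"
    proof (cases rule: toggle_graphE)
      case (up v)
      have k: "l a \<in> {1..N}" and an: "a \<in> new_faces F (l a)" using l new up(1) by auto
      have "toggle v a \<in> new_faces F (l a)"
        using toggle_closedD(1)[OF facet(1)[OF k] an] up(4) by (simp add: f_def)
      then show ?thesis using new[OF k] up(3,5) by (simp add: toggle_def)
    next
      case (down x)
      then show ?thesis using l[OF down(1)] by (intro l_le) auto
    qed
  next
    fix n
    let ?R = "{(a, b) \<in> toggle_graph order_complex f. l a = n \<and> l b = n}"
    show "acyclic ?R"
    proof (cases "n \<in> {1..N}")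
      case True
      have "?R \<subseteq> toggle_graph (new_faces F n) (facet_pivot F n)"
      proof (rule subrelI)
        fix a b assume "(a, b) \<in> ?R"
        then have ab: "(a, b) \<in> toggle_graph order_complex f" and "l a = n" "l b = n" by auto
        then have "f a = facet_pivot F n a" "a \<in> order_complex \<longleftrightarrow> a \<in> new_faces F n"
          "b \<in> order_complex \<longleftrightarrow> b \<in> new_faces F n"
          using new[OF True] by (auto simp: f_def)
        with ab show "(a, b) \<in> toggle_graph (new_faces F n) (facet_pivot F n)"
          by (auto elim!: toggle_graphE intro: toggle_graph_upI toggle_graph_downI)
      qed
      then show ?thesis using facet(2)[OF True] acyclic_subset by blast
    next
      case False
      \<comment> \<open>Every face has its level in \<open>{1..N}\<close>, so no edges occur at
        other levels.\<close>
      then have empty: "?R = {}" using l(1) by (auto elim!: toggle_graphE)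
      show ?thesis unfolding empty by (simp add: acyclic_def)
    qed
  qed
  then have "acyclic (matching_digraph order_complex (toggle_pairs order_complex f))"
    using matching_digraph_toggle_pairs[OF closed] by (rule acyclic_subset)
  then show ?thesis
    unfolding acyclic_matching_def M using face_matching_toggle_pairs[OF closed] by blast
qed

end
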